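(* Fix $I\in\mathbb{N}$. (a) Let $\psi^0\in\mathcal{D}^1:=\mathcal{D}\cap \mathcal{C}^1(\mathbb{R}_+,\mathbb{R}_+)^I$ and define $\psi_i(u,t):=(\Upsilon^{-1}\circ\theta_t\circ\Upsilon\circ\psi^0)_i(u)$. Then $\psi_i\in C^1(\mathbb{R}_+^2,\mathbb{R}_+)$ for each $i$, $\psi(\cdot,t)\in\mathcal{D}^1$ for all $t\ge0$, and \[\partial_t\psi_i=-v_i^{\mathrm{eff}}\left(\partial_u\psi\right)\partial_u\psi_i,\quad i=1,\dots,I,\qquad \psi(\cdot,0)=\psi^0.\] Moreover, $\psi$ is the unique solution of this problem in the class of $\psi \in C^1(\mathbb{R}_+^2,\mathbb{R}_+)^I$ with $\psi(\cdot,t) \in \mathcal{D}^1$ for all $t \ge0$. (b) Let $\rho^0\in \mathcal{D}_{\mathrm{density}}$, set $\psi^0_i(u):=\int_0^u\rho^0_i(u')du'$ and define $\psi_i(u,t)$ as in (a). Then $\psi_i\in C^2(\mathbb{R}_+^2,\mathbb{R}_+)$ for each $i$, $\rho_i(u,t):=\partial_u\psi_i(u,t)$ satisfies $\rho_i\in C^1(\mathbb{R}_+^2,\mathbb{R}_+)$, $\rho(\cdot,t)\in\mathcal{D}_{\mathrm{density}}$ for all $t\ge0$, and \[\partial_t \rho_i =- \partial_u \left( v_i^{\mathrm{eff}}(\rho) \rho_i\right),\quad \rho_i(\cdot,0)=\rho^0_i,\qquad i=1,\dots,I.\] Moreover, $\rho$ is the unique solution of this problem in the class of $\rho \in C^1(\mathbb{R}_+^2,\mathbb{R}_+)^{I}$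 with $\rho(\cdot,t) \in \mathcal{D}_{\mathrm{density}}$ for all $t \ge0$.
   Context: $\mathcal{C}=\{f\in C(\mathbb{R}_+,\mathbb{R}_+):f(0)=0,f\text{ non-decreasing}\}$, $\mathcal{C}^\uparrow=\{f\in\mathcal{C}:f\text{ strictly increasing},\lim_{u\to\infty}f(u)=\infty\}$. For $\psi\in\mathcal{C}^I$, $\phi_i(u)=u-\sum_{j=1}^I2(i\wedge j)\psi_j(u)$. $\mathcal{D}=\{\psi\in\mathcal{C}^I:\phi_I\in\mathcal{C}^\uparrow,\sum_{i=1}^Ii\sup_{u_1\neq u_2}\frac{\psi_i(u_1)-\psi_i(u_2)}{\phi_i(u_1)-\phi_i(u_2)}<\frac12\}$ (each $\phi_i$ is then in $\mathcal{C}^\uparrow$). $\Upsilon(\psi)_i:=\psi_i\circ\phi_i^{-1}$; $\Upsilon$ is a bijection from $\mathcal{D}$ onto $\bar{\mathcal{D}}=\{\bar\psi\in\mathcal{C}^I:\sum_ii\sup_{z_1\neq z_2}\frac{\bar\psi_i(z_1)-\bar\psi_i(z_2)}{z_1-z_2}<\frac12\}$, with inverse $\Upsilon^{-1}$. $(\theta_t\bar\psi)_i(z):=\bar\psi_i((z-it)\vee0)$, which maps $\bar{\mathcal{D}}$ into itself. $\mathcal{C}^1(\mathbb{R}_+,\mathbb{R}_+)$: functions $f:\mathbb{R}_+\to\mathbb{R}_+$ whose extension by $0$ on $(-\infty,0)$ is $C^1$ on $\mathbb{R}$. Effective speeds: for $\rho\in\mathbb{R}_+^I$ with $\sum_i 2i\rho_i<1$,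 $M(\rho)$ has $M_{ii}=1-\sum_{j\ne i}2(i\wedge j)\rho_j$, $M_{ij}=2(i\wedge j)\rho_j$ ($i\neq j$), and $v^{\mathrm{eff}}(\rho)=M(\rho)^{-1}(1,2,\dots,I)^T$ (evaluated pointwise in $(u,t)$). $\mathcal{D}_{\mathrm{density}}$: $\rho\in\mathcal{C}^1(\mathbb{R}_+,\mathbb{R}_+)^I$ with $\sum_i2i\rho_i(u)<1$ for all $u$ and $\sum_ii\sup_u\frac{\rho_i(u)}{1-\sum_j2(i\wedge j)\rho_j(u)}<\frac12$. *)

theory Defs
  imports "HOL-Analysis.Analysis"
begin

text \<open>Vectors of functions indexed by i in {1..I} are represented as
  functions nat => real => real; only the indices 1..I and arguments in
  R_+ = {0..} matter.  Time-dependent families are nat => real => real => real,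
  psi i u t.\<close>

definition Cc :: "(real \<Rightarrow> real) \<Rightarrow> bool" where
  "Cc f \<longleftrightarrow> continuous_on {0..} f \<and> f 0 = 0 \<and> mono_on {0..} f \<and> (\<forall>u\<ge>0. 0 \<le> f u)"

definition Cup :: "(real \<Rightarrow> real) \<Rightarrow> bool" where
  "Cup f \<longleftrightarrow> Cc f \<and> strict_mono_on {0..} f \<and> filterlim f at_top at_top"

definition C1plus :: "(real \<Rightarrow> real) \<Rightarrow> bool" where
  "C1plus f \<longleftrightarrow> (\<lambda>x. if x < 0 then 0 else f x) C1_differentiable_on UNIV \<and> (\<forall>u\<ge>0. 0 \<le> f u)"

definition phi :: "nat \<Rightarrow> (nat \<Rightarrow> real \<Rightarrow> real) \<Rightarrow> nat \<Rightarrow> real \<Rightarrow> real" where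
  "phi I \<psi> i u = u - (\<Sum>j=1..I. 2 * real (min i j) * \<psi> j u)"

definition ratio_set :: "nat \<Rightarrow> (nat \<Rightarrow> real \<Rightarrow> real) \<Rightarrow> nat \<Rightarrow> real set" where
  "ratio_set I \<psi> i = {(\<psi> i u1 - \<psi> i u2) / (phi I \<psi> i u1 - phi I \<psi> i u2) | u1 u2.
       0 \<le> u1 \<and> 0 \<le> u2 \<and> u1 \<noteq> u2}"

definition inD :: "nat \<Rightarrow> (nat \<Rightarrow> real \<Rightarrow> real) \<Rightarrow> bool" where
  "inD I \<psi> \<longleftrightarrow> (\<forall>i\<in>{1..I}. Cc (\<psi> i)) \<and> Cup (phi I \<psi> I) \<and>
     (\<forall>i\<in>{1..I}. bdd_above (ratio_set I \<psi> i)) \<and>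
     (\<Sum>i=1..I. real i * Sup (ratio_set I \<psi> i)) < 1/2"

definition inD1 :: "nat \<Rightarrow> (nat \<Rightarrow> real \<Rightarrow> real) \<Rightarrow> bool" where
  "inD1 I \<psi> \<longleftrightarrow> inD I \<psi> \<and> (\<forall>i\<in>{1..I}. C1plus (\<psi> i))"

definition Ups :: "nat \<Rightarrow> (nat \<Rightarrow> real \<Rightarrow> real) \<Rightarrow> nat \<Rightarrow> real \<Rightarrow> real" where
  "Ups I \<psi> i z = \<psi> i (the_inv_into {0..} (phi I \<psi> i) z)"

text \<open>Inverse of Upsilon: the (values on R_+ of the) unique element of D whose image
  agrees with the given function on R_+.\<close>
definition Ups_inv :: "nat \<Rightarrow> (nat \<Rightarrow> real \<Rightarrow> real) \<Rightarrow> nat \<Rightarrow> real \<Rightarrow> real" where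
  "Ups_inv I \<psi>b i u = (THE v. \<exists>\<psi>. inD I \<psi> \<and> (\<forall>j\<in>{1..I}. \<forall>z\<ge>0. Ups I \<psi> j z = \<psi>b j z) \<and> \<psi> i u = v)"

definition theta :: "real \<Rightarrow> (nat \<Rightarrow> real \<Rightarrow> real) \<Rightarrow> nat \<Rightarrow> real \<Rightarrow> real" where
  "theta t \<psi>b i z = \<psi>b i (max (z - real i * t) 0)"

definition psi_flow :: "nat \<Rightarrow> (nat \<Rightarrow> real \<Rightarrow> real) \<Rightarrow> nat \<Rightarrow> real \<Rightarrow> real \<Rightarrow> real" where
  "psi_flow I \<psi>0 i u t = Ups_inv I (theta t (Ups I \<psi>0)) i u"

definition Mmat :: "nat \<Rightarrow> (nat \<Rightarrow> real) \<Rightarrow> nat \<Rightarrow> nat \<Rightarrow> real" where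
  "Mmat I \<rho> i j = (if i = j then 1 - (\<Sum>k\<in>{1..I}-{i}. 2 * real (min i k) * \<rho> k)
                    else 2 * real (min i j) * \<rho> j)"

definition veff :: "nat \<Rightarrow> (nat \<Rightarrow> real) \<Rightarrow> nat \<Rightarrow> real" where
  "veff I \<rho> = (THE v. (\<forall>k\<in>{1..I}. (\<Sum>j=1..I. Mmat I \<rho> k j * v j) = real k) \<and>
                      (\<forall>j. j \<notin> {1..I} \<longrightarrow> v j = 0))"

definition dens_set :: "nat \<Rightarrow> (nat \<Rightarrow> real \<Rightarrow> real) \<Rightarrow> nat \<Rightarrow> real set" where
  "dens_set I \<rho> i = (\<lambda>u. \<rho> i u / (1 - (\<Sum>j=1..I. 2 * real (min i j) * \<rho> j u))) ` {0..}"

definition inDdens :: "nat \<Rightarrow> (nat \<Rightarrow> real \<Rightarrow> real) \<Rightarrow> bool" where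
  "inDdens I \<rho> \<longleftrightarrow> (\<forall>i\<in>{1..I}. C1plus (\<rho> i)) \<and>
     (\<forall>u\<ge>0. (\<Sum>i=1..I. 2 * real i * \<rho> i u) < 1) \<and>
     (\<forall>i\<in>{1..I}. bdd_above (dens_set I \<rho> i)) \<and>
     (\<Sum>i=1..I. real i * Sup (dens_set I \<rho> i)) < 1/2"

definition Q :: "(real \<times> real) set" where
  "Q = {0..} \<times> {0..}"

definition du :: "(real \<Rightarrow> real \<Rightarrow> real) \<Rightarrow> real \<Rightarrow> real \<Rightarrow> real" where
  "du g u t = vector_derivative (\<lambda>x. g x t) (at u within {0..})"

definition dt :: "(real \<Rightarrow> real \<Rightarrow> real) \<Rightarrow> real \<Rightarrow> real \<Rightarrow> real" where
  "dt g u t = vector_derivative (\<lambda>s. g u s) (at t within {0..})"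

definition C1q :: "(real \<Rightarrow> real \<Rightarrow> real) \<Rightarrow> bool" where
  "C1q g \<longleftrightarrow> (\<exists>gu gt.
     (\<forall>u\<ge>0. \<forall>t\<ge>0. ((\<lambda>p. g (fst p) (snd p)) has_derivative (\<lambda>h. gu u t * fst h + gt u t * snd h))
                       (at (u, t) within Q)) \<and>
     continuous_on Q (\<lambda>p. gu (fst p) (snd p)) \<and> continuous_on Q (\<lambda>p. gt (fst p) (snd p)))"

definition C2q :: "(real \<Rightarrow> real \<Rightarrow> real) \<Rightarrow> bool" where
  "C2q g \<longleftrightarrow> (\<exists>gu gt.
     (\<forall>u\<ge>0. \<forall>t\<ge>0. ((\<lambda>p. g (fst p) (snd p)) has_derivative (\<lambda>h. gu u t * fst h + gt u t * snd h))
                       (at (u, t) within Q)) \<and>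
     C1q gu \<and> C1q gt)"

definition nonnegq :: "(real \<Rightarrow> real \<Rightarrow> real) \<Rightarrow> bool" where
  "nonnegq g \<longleftrightarrow> (\<forall>u\<ge>0. \<forall>t\<ge>0. 0 \<le> g u t)"

definition sol_a :: "nat \<Rightarrow> (nat \<Rightarrow> real \<Rightarrow> real) \<Rightarrow> (nat \<Rightarrow> real \<Rightarrow> real \<Rightarrow> real) \<Rightarrow> bool" where
  "sol_a I \<psi>0 \<psi> \<longleftrightarrow>
     (\<forall>i\<in>{1..I}. C1q (\<psi> i) \<and> nonnegq (\<psi> i)) \<and>
     (\<forall>t\<ge>0. inD1 I (\<lambda>i u. \<psi> i u t)) \<and>
     (\<forall>i\<in>{1..I}. \<forall>u\<ge>0. \<forall>t\<ge>0.
        dt (\<psi> i) u t = - veff I (\<lambda>j. du (\<psi> j) u t) i * du (\<psi> i) u t) \<and>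
     (\<forall>i\<in>{1..I}. \<forall>u\<ge>0. \<psi> i u 0 = \<psi>0 i u)"

definition sol_b :: "nat \<Rightarrow> (nat \<Rightarrow> real \<Rightarrow> real) \<Rightarrow> (nat \<Rightarrow> real \<Rightarrow> real \<Rightarrow> real) \<Rightarrow> bool" where
  "sol_b I \<rho>0 \<rho> \<longleftrightarrow>
     (\<forall>i\<in>{1..I}. C1q (\<rho> i) \<and> nonnegq (\<rho> i)) \<and>
     (\<forall>t\<ge>0. inDdens I (\<lambda>i u. \<rho> i u t)) \<and>
     (\<forall>i\<in>{1..I}. \<forall>u\<ge>0. \<forall>t\<ge>0.
        ((\<lambda>x. veff I (\<lambda>j. \<rho> j x t) i * \<rho> i x t) has_real_derivative (- dt (\<rho> i) u t))
          (at u within {0..})) \<and>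
     (\<forall>i\<in>{1..I}. \<forall>u\<ge>0. \<rho> i u 0 = \<rho>0 i u)"

end

theory Submission
  imports Defs
begin

text \<open>
  Let \<open>E = \<Upsilon> \<psi>\<^sup>0\<close>, extended by 0 to the negative axis. The evolved family at time
  \<open>t\<close> solves \<open>y\<^sub>i = u - \<Sum>\<^sub>j 2 (i \<and> j) E\<^sub>j (y\<^sub>j - j t)\<close>, \<open>y\<^sub>i = \<phi>\<^sub>i (u, t)\<close>. Because of the kernel \<open>i \<and> j\<close>
  this system is triangular once the last unknown \<open>w = y\<^sub>I\<close> is prescribed: \<open>y\<^bsub>I-1\<^esub>, y\<^bsub>I-2\<^esub>, \<dots>, y\<^sub>0 = u\<close>
  are then explicit, and \<open>u\<close> is a function of \<open>(w, t)\<close> as smooth as \<open>E\<close> with \<open>\<partial>u/\<partial>w \<ge> 1\<close>.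
  Inverting this scalar function gives existence, uniqueness and regularity of the flow.
  With affine nonlinearities the same argument shows that \<open>M(\<rho>)\<close> is invertible.

  Differentiating \<open>\<psi>\<^sub>i = E\<^sub>i (\<phi>\<^sub>i - i t)\<close> in \<open>u\<close> and \<open>t\<close> yields the transport equation with a speed that solves
  \<open>M v = (1, \<dots>, I)\<close>. Conversely, for a solution of the transport equation \<open>\<psi>\<^sub>i\<close> is constant along the
  curves \<open>\<phi>\<^sub>i (u(s), s) - i s = const\<close>, which forces \<open>\<psi>\<^sub>i = E\<^sub>i (\<phi>\<^sub>i - i t)\<close>, so uniqueness for the system
  gives uniqueness for the equation. Densities are reduced to this case by integrating in \<open>u\<close>.
\<close>


section \<open>Functions of class C^k on the plane\<close>

text \<open>The set \<open>S\<close> lets one notion cover derivatives on the whole plane and, with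
  \<open>S = Q\<close>, the one-sided ones at the boundary of the quadrant.\<close>

abbreviation has_grad :: "(real \<Rightarrow> real \<Rightarrow> real) \<Rightarrow> real \<Rightarrow> real \<Rightarrow> real \<Rightarrow> real \<Rightarrow> (real \<times> real) set \<Rightarrow> bool" where
  "has_grad g a b u t S \<equiv>
     ((\<lambda>p. g (fst p) (snd p)) has_derivative (\<lambda>h. a * fst h + b * snd h)) (at (u, t) within S)"

text \<open>Smoothness is taken on the whole plane, where composition and implicit functions meet no
  boundary. A function of one variable enters as one that is constant in \<open>t\<close>.\<close>

fun Ck :: "nat \<Rightarrow> (real \<Rightarrow> real \<Rightarrow> real) \<Rightarrow> bool" where
  "Ck 0 g \<longleftrightarrow> continuous_on UNIV (\<lambda>p. g (fst p) (snd p))"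
| "Ck (Suc k) g \<longleftrightarrow> (\<exists>gu gt. (\<forall>u t. has_grad g (gu u t) (gt u t) u t UNIV) \<and> Ck k gu \<and> Ck k gt)"

lemma Ck_continuous: "Ck k g \<Longrightarrow> continuous_on UNIV (\<lambda>p. g (fst p) (snd p))"
proof (cases k)
  case (Suc n)
  assume "Ck k g"
  with Suc obtain gu gt where "\<And>u t. has_grad g (gu u t) (gt u t) u t UNIV" by auto
  then have "\<And>p. isCont (\<lambda>p. g (fst p) (snd p)) p"
    using has_derivative_continuous by fastforce
  then show ?thesis by (simp add: continuous_at_imp_continuous_on)
qed simp

lemma Ck_SucI:
  assumes "\<And>u t. has_grad g (gu u t) (gt u t) u t UNIV" "Ck k gu" "Ck k gt"
  shows "Ck (Suc k) g"
  unfolding Ck.simps using assms by blast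

lemma Ck_SucD: "Ck (Suc k) g \<Longrightarrow> Ck k g"
proof (induction k arbitrary: g)
  case 0
  then show ?case using Ck_continuous by (metis Ck.simps(1))
next
  case (Suc k)
  obtain gu gt where g: "\<forall>u t. has_grad g (gu u t) (gt u t) u t UNIV" "Ck (Suc k) gu" "Ck (Suc k) gt"
    using Suc.prems Ck.simps(2)[of "Suc k" g] by blast
  show ?case
    unfolding Ck.simps(2)[of k g] using g Suc.IH by blast
qed

lemma Ck_const [intro!]: "Ck k (\<lambda>u t. c)"
proof (induction k arbitrary: c)
  case (Suc k)
  have "\<forall>u t. has_grad (\<lambda>u t. c) 0 0 u t UNIV" by auto
  then show ?case
    unfolding Ck.simps using Suc.IH by fast
qed auto

lemma Ck_fst [intro!]: "Ck k (\<lambda>u t. u)"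
proof (cases k)
  case (Suc n)
  have "\<forall>u t. has_grad (\<lambda>u t. u) 1 0 u t UNIV" by (auto intro!: derivative_eq_intros)
  then show ?thesis
    unfolding Suc Ck.simps using Ck_const by fast
qed (auto intro!: continuous_intros)

lemma Ck_snd [intro!]: "Ck k (\<lambda>u t. t)"
proof (cases k)
  case (Suc n)
  have "\<forall>u t. has_grad (\<lambda>u t. t) 0 1 u t UNIV" by (auto intro!: derivative_eq_intros)
  then show ?thesis
    unfolding Suc Ck.simps using Ck_const by fast
qed (auto intro!: continuous_intros)

lemma Ck_add: "Ck k f \<Longrightarrow> Ck k g \<Longrightarrow> Ck k (\<lambda>u t. f u t + g u t)"
proof (induction k arbitrary: f g)
  case 0
  then show ?case by (auto intro!: continuous_intros)
next
  case (Suc k)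
  obtain fu ft where f: "\<And>u t. has_grad f (fu u t) (ft u t) u t UNIV" "Ck k fu" "Ck k ft"
    using Suc.prems(1) by auto
  obtain gu gt where g: "\<And>u t. has_grad g (gu u t) (gt u t) u t UNIV" "Ck k gu" "Ck k gt"
    using Suc.prems(2) by auto
  have "has_grad (\<lambda>u t. f u t + g u t) (fu u t + gu u t) (ft u t + gt u t) u t UNIV" for u t
    by (rule has_derivative_eq_rhs[OF has_derivative_add[OF f(1) g(1)]]) (auto simp: algebra_simps)
  moreover have "Ck k (\<lambda>u t. fu u t + gu u t)" "Ck k (\<lambda>u t. ft u t + gt u t)"
    using Suc.IH f g by auto
  ultimately show ?case by (rule Ck_SucI)
qed

lemma Ck_mult: "Ck k f \<Longrightarrow> Ck k g \<Longrightarrow> Ck k (\<lambda>u t. f u t * g u t)"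
proof (induction k arbitrary: f g)
  case 0
  then show ?case by (auto intro!: continuous_intros)
next
  case (Suc k)
  obtain fu ft where f: "\<And>u t. has_grad f (fu u t) (ft u t) u t UNIV" "Ck k fu" "Ck k ft"
    using Suc.prems(1) by auto
  obtain gu gt where g: "\<And>u t. has_grad g (gu u t) (gt u t) u t UNIV" "Ck k gu" "Ck k gt"
    using Suc.prems(2) by auto
  have "has_grad (\<lambda>u t. f u t * g u t) (f u t * gu u t + fu u t * g u t)
      (f u t * gt u t + ft u t * g u t) u t UNIV" for u t
    by (rule has_derivative_eq_rhs[OF has_derivative_mult[OF f(1) g(1)]]) (auto simp: algebra_simps)
  moreover have "Ck k (\<lambda>u t. f u t * gu u t + fu u t * g u t)" "Ck k (\<lambda>u t. f u t * gt u t + ft u t * g u t)"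
    by (intro Ck_add Suc.IH f g Ck_SucD[OF Suc.prems(1)] Ck_SucD[OF Suc.prems(2)])+
  ultimately show ?case by (rule Ck_SucI)
qed

lemma Ck_diff: "Ck k f \<Longrightarrow> Ck k g \<Longrightarrow> Ck k (\<lambda>u t. f u t - g u t)"
  using Ck_add[of k f "\<lambda>u t. (-1) * g u t"] Ck_mult[OF Ck_const[of k "-1"], of g] by simp

lemma Ck_sum: "(\<And>j. j \<in> A \<Longrightarrow> Ck k (f j)) \<Longrightarrow> Ck k (\<lambda>u t. \<Sum>j\<in>A. f j u t)"
  by (induction A rule: infinite_finite_induct) (auto intro!: Ck_add)

lemma has_grad_compose:
  assumes f: "has_grad f a b (x u t) (y u t) UNIV"
    and x: "has_grad x xu xt u t S" and y: "has_grad y yu yt u t S"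
  shows "has_grad (\<lambda>u t. f (x u t) (y u t)) (a * xu + b * yu) (a * xt + b * yt) u t S"
proof -
  have "((\<lambda>p. (x (fst p) (snd p), y (fst p) (snd p))) has_derivative
      (\<lambda>h. (xu * fst h + xt * snd h, yu * fst h + yt * snd h))) (at (u, t) within S)"
    by (rule has_derivative_Pair[OF x y])
  from has_derivative_compose[OF this, of "\<lambda>p. f (fst p) (snd p)", simplified, OF f]
  show ?thesis by (rule has_derivative_eq_rhs) (auto simp: algebra_simps)
qed

lemma Ck_compose:
  "Ck k f \<Longrightarrow> Ck k x \<Longrightarrow> Ck k y \<Longrightarrow> Ck k (\<lambda>u t. f (x u t) (y u t))"
proof (induction k arbitrary: f x y)
  case 0
  have "continuous_on UNIV (\<lambda>p. (x (fst p) (snd p), y (fst p) (snd p)))"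
    using 0 by (auto intro!: continuous_intros)
  from continuous_on_compose2[OF _ this, of UNIV "\<lambda>p. f (fst p) (snd p)"] 0
  show ?case by auto
next
  case (Suc k)
  obtain fu ft where f: "\<And>u t. has_grad f (fu u t) (ft u t) u t UNIV" "Ck k fu" "Ck k ft"
    using Suc.prems(1) by auto
  obtain xu xt where x: "\<And>u t. has_grad x (xu u t) (xt u t) u t UNIV" "Ck k xu" "Ck k xt"
    using Suc.prems(2) by auto
  obtain yu yt where y: "\<And>u t. has_grad y (yu u t) (yt u t) u t UNIV" "Ck k yu" "Ck k yt"
    using Suc.prems(3) by auto
  have "has_grad (\<lambda>u t. f (x u t) (y u t))
      (fu (x u t) (y u t) * xu u t + ft (x u t) (y u t) * yu u t)
      (fu (x u t) (y u t) * xt u t + ft (x u t) (y u t) * yt u t) u t UNIV" for u t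
    by (rule has_grad_compose[OF f(1) x(1) y(1)])
  moreover
  note comp = Suc.IH[OF _ Ck_SucD[OF Suc.prems(2)] Ck_SucD[OF Suc.prems(3)]]
  have "Ck k (\<lambda>u t. fu (x u t) (y u t) * xu u t + ft (x u t) (y u t) * yu u t)"
      "Ck k (\<lambda>u t. fu (x u t) (y u t) * xt u t + ft (x u t) (y u t) * yt u t)"
    by (intro Ck_add Ck_mult comp[OF f(2)] comp[OF f(3)] x y)+
  ultimately show ?case by (rule Ck_SucI)
qed

lemma Ck_inverse:
  "Ck k f \<Longrightarrow> (\<And>u t. f u t \<noteq> 0) \<Longrightarrow> Ck k (\<lambda>u t. inverse (f u t))"
proof (induction k)
  case 0
  then show ?case by (auto intro!: continuous_intros)
next
  case (Suc k)
  obtain fu ft where f: "\<And>u t. has_grad f (fu u t) (ft u t) u t UNIV" "Ck k fu" "Ck k ft"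
    using Suc.prems(1) by auto
  let ?i = "\<lambda>u t. inverse (f u t)"
  have "has_grad ?i ((-1) * (?i u t * fu u t * ?i u t)) ((-1) * (?i u t * ft u t * ?i u t)) u t UNIV" for u t
    by (rule has_derivative_eq_rhs[OF Deriv.has_derivative_inverse[OF _ f(1)]])
      (use Suc.prems(2) in \<open>auto simp: algebra_simps\<close>)
  moreover have "Ck k ?i" by (intro Suc.IH Ck_SucD[OF Suc.prems(1)] Suc.prems(2))
  then have "Ck k (\<lambda>u t. (-1) * (?i u t * fu u t * ?i u t))" "Ck k (\<lambda>u t. (-1) * (?i u t * ft u t * ?i u t))"
    by (intro Ck_mult Ck_const f; assumption)+
  ultimately show ?case by (rule Ck_SucI)
qed

lemma has_grad_fst:
  assumes "(f has_real_derivative d) (at u)"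
  shows "has_grad (\<lambda>u t. f u) d 0 u t UNIV"
  using has_derivative_compose[OF has_derivative_fst[OF has_derivative_ident], of f "(*) d" "(u,t)" UNIV] assms
  by (simp add: has_field_derivative_def)

lemma Ck_Suc_fst:
  assumes "\<And>x. (f has_real_derivative f' x) (at x)" "Ck k (\<lambda>u t. f' u)"
  shows "Ck (Suc k) (\<lambda>u t. f u)"
proof -
  have "\<forall>u t. has_grad (\<lambda>u t. f u) (f' u) 0 u t UNIV" using has_grad_fst assms by blast
  then show ?thesis unfolding Ck.simps using assms Ck_const by fast
qed

section \<open>Derivatives along lines and curves, and implicit functions\<close>

lemma has_grad_du:
  assumes "has_grad g a b u t S" "T \<times> {t} \<subseteq> S" 
  shows "((\<lambda>x. g x t) has_real_derivative a) (at u within T)"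
proof -
  have "((\<lambda>x. (x, t)) has_derivative (\<lambda>h. (h, 0))) (at u within T)"
    by (auto intro!: derivative_eq_intros)
  moreover have "has_grad g a b u t ((\<lambda>x. (x, t)) ` T)"
    using assms by (auto intro: has_derivative_subset)
  ultimately have "((\<lambda>x. g (fst (x, t)) (snd (x, t))) has_derivative (\<lambda>h. a * fst (h, 0::real) + b * snd (h, 0))) (at u within T)"
    by (rule has_derivative_in_compose)
  then show ?thesis
    unfolding has_field_derivative_def fst_conv snd_conv by (rule has_derivative_eq_rhs) auto
qed

lemma has_grad_curve:
  assumes "has_grad g a b (x s) s S" "(x has_real_derivative x') (at s within T)"
    "\<And>r. r \<in> T \<Longrightarrow> (x r, r) \<in> S"
  shows "((\<lambda>s. g (x s) s) has_real_derivative a * x' + b) (at s within T)"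
proof -
  have "((\<lambda>r. (x r, r)) has_derivative (\<lambda>h. (x' * h, h))) (at s within T)"
    using assms(2) by (auto intro!: derivative_eq_intros simp: has_field_derivative_def)
  moreover have "has_grad g a b (x s) s ((\<lambda>r. (x r, r)) ` T)"
    using assms by (auto intro: has_derivative_subset)
  ultimately have "((\<lambda>r. g (x r) r) has_derivative (\<lambda>h. a * (x' * h) + b * h)) (at s within T)"
    using has_derivative_in_compose[of "\<lambda>r. (x r, r)" _ s T "\<lambda>p. g (fst p) (snd p)"]
    by fastforce
  then show ?thesis
    unfolding has_field_derivative_def by (rule has_derivative_eq_rhs) (auto simp: algebra_simps)
qed

lemma has_grad_dt:
  assumes "has_grad g a b u t S" "{u} \<times> T \<subseteq> S"
  shows "((\<lambda>s. g u s) has_real_derivative b) (at t within T)"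
  using has_grad_curve[of g a b "\<lambda>_. u" t S 0 T] assms by auto

text \<open>Pointwise implicit differentiation relative to sets, so that it also applies at boundary
  points of the quadrant. Since \<open>F\<close> is constant on the graph of \<open>w\<close>, the
  linear part \<open>a * x + L k\<close> of its increment is as small as the error term. Continuity
  of \<open>w\<close> keeps the graph inside the region where that error estimate holds.\<close>

lemma implicit_has_derivative:
  fixes F :: "real \<times> 'a::real_normed_vector \<Rightarrow> real" and w :: "'a \<Rightarrow> real"
  assumes F: "(F has_derivative (\<lambda>h. a * fst h + L (snd h))) (at (w p0, p0) within X)"
    and a: "a \<noteq> 0"
    and w: "continuous (at p0 within T) w"
    and c: "\<And>p. p \<in> T \<Longrightarrow> F (w p, p) = c" and X: "\<And>p. p \<in> T \<Longrightarrow> (w p, p) \<in> X" and p0: "p0 \<in> T"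
  shows "(w has_derivative (\<lambda>k. - L k / a)) (at p0 within T)"
proof -
  have bl: "bounded_linear (\<lambda>h. a * fst h + L (snd h))" using F by (rule has_derivative_bounded_linear)
  have "bounded_linear (\<lambda>k. (\<lambda>h. a * fst h + L (snd h)) (0, k))"
    by (rule bounded_linear_compose[OF bl]) (intro bounded_linear_intros)
  then have L: "bounded_linear L" by simp
  then obtain K where K: "K > 0" "\<And>k. norm (L k) \<le> norm k * K"
    using bounded_linear.pos_bounded by blast
  have blw: "bounded_linear (\<lambda>k. - L k / a)"
    using bounded_linear_compose[OF bounded_linear_mult_right[of "-1/a"] L] by simp
  show ?thesis
    unfolding has_derivative_within_alt
  proof (intro conjI allI impI blw)
    fix e :: real assume e: "e > 0"
    define C where "C = 2 * K / \<bar>a\<bar> + 2"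
    have C: "C > 0" using K(1) a by (auto simp: C_def intro!: add_nonneg_pos)
    \<comment> \<open>The bound \<open>\<bar>a\<bar> / 2\<close> lets the term in
      \<open>\<bar>x\<bar>\<close> be absorbed, which gives
      \<open>\<bar>x\<bar> + norm k \<le> norm k * C\<close>. The second bound then turns the error
      into \<open>e * norm k\<close> after division by \<open>\<bar>a\<bar>\<close>.\<close>
    define e' where "e' = min (\<bar>a\<bar> / 2) (e * \<bar>a\<bar> / C)"
    have e': "e' > 0" using e a C by (auto simp: e'_def)
    obtain d where d: "d > 0" "\<And>y. y \<in> X \<Longrightarrow> norm (y - (w p0, p0)) < d \<Longrightarrow>
        norm (F y - F (w p0, p0) - (a * fst (y - (w p0, p0)) + L (snd (y - (w p0, p0))))) \<le> e' * norm (y - (w p0, p0))"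
      using F e' unfolding has_derivative_within_alt by blast
    obtain d2 where d2: "d2 > 0" "\<And>p. p \<in> T \<Longrightarrow> dist p p0 < d2 \<Longrightarrow> dist (w p) (w p0) < d / 2"
      using w d(1) unfolding continuous_within_eps_delta by (meson half_gt_zero)
    show "\<exists>d>0. \<forall>y\<in>T. norm (y - p0) < d \<longrightarrow> norm (w y - w p0 - - L (y - p0) / a) \<le> e * norm (y - p0)"
    proof (intro exI[of _ "min d2 (d/2)"] conjI ballI impI)
      fix p assume p: "p \<in> T" "norm (p - p0) < min d2 (d / 2)"
      define x where "x = w p - w p0"
      define k where "k = p - p0"
      have nle: "norm ((x, k)) \<le> \<bar>x\<bar> + norm k"
        using norm_Pair_le[of x k] by simp
      have "\<bar>x\<bar> < d / 2" using d2(2)[OF p(1)] p(2) by (simp add: dist_norm x_def)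
      then have "norm ((w p, p) - (w p0, p0)) < d" using nle p(2) by (simp add: x_def k_def)
      from d(2)[OF X[OF p(1)] this] have "\<bar>a * x + L k\<bar> \<le> e' * norm (x, k)"
        using c[OF p(1)] c[OF p0] by (simp add: x_def k_def abs_minus_commute)
      also have "\<dots> \<le> e' * (\<bar>x\<bar> + norm k)" using nle e' by simp
      finally have main: "\<bar>a * x + L k\<bar> \<le> e' * (\<bar>x\<bar> + norm k)" .
      have "\<bar>a\<bar> * \<bar>x\<bar> \<le> \<bar>a * x + L k\<bar> + \<bar>L k\<bar>" by (simp flip: abs_mult)
      also have "\<dots> \<le> \<bar>a\<bar> / 2 * (\<bar>x\<bar> + norm k) + norm k * K"
      proof -
        have "e' * (\<bar>x\<bar> + norm k) \<le> \<bar>a\<bar> / 2 * (\<bar>x\<bar> + norm k)"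
          by (rule mult_right_mono) (simp_all only: e'_def min.cobounded1 add_nonneg_nonneg abs_ge_zero norm_ge_zero)
        then show ?thesis using main K(2)[of k] by simp
      qed
      finally have "\<bar>a\<bar> * \<bar>x\<bar> \<le> norm k * (\<bar>a\<bar> + 2 * K)" by (simp add: field_simps)
      then have "\<bar>x\<bar> \<le> norm k * (1 + 2 * K / \<bar>a\<bar>)" using a by (simp add: field_simps)
      then have xk: "\<bar>x\<bar> + norm k \<le> norm k * C" by (simp add: C_def algebra_simps)
      have "\<bar>a * x + L k\<bar> \<le> e' * (norm k * C)" using main xk e' by (meson mult_left_mono less_imp_le order_trans)
      also have "\<dots> \<le> (e * \<bar>a\<bar> / C) * (norm k * C)" using C by (intro mult_right_mono) (auto simp: e'_def)
      also have "\<dots> = \<bar>a\<bar> * (e * norm k)" using C by simp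
      finally have "\<bar>a\<bar> * \<bar>x + L k / a\<bar> \<le> \<bar>a\<bar> * (e * norm k)"
        using a by (simp add: algebra_simps flip: abs_mult)
      then show "norm (w p - w p0 - - L (p - p0) / a) \<le> e * norm (p - p0)"
        using a by (simp add: x_def k_def)
    qed (use d d2 in auto)
  qed
qed

text \<open>For fixed \<open>a\<close> the sign of \<open>G a p - c\<close> decides on which side of
  \<open>a\<close> the root \<open>w p\<close> lies, and by continuity in \<open>p\<close> this sign
  persists near \<open>p0\<close>. As \<open>A\<close> is closed upwards, a point \<open>a\<close>
  outside \<open>A\<close> lies below every root.\<close>

lemma continuous_within_implicit:
  fixes G :: "real \<Rightarrow> 'a::metric_space \<Rightarrow> real"
  assumes mono: "\<And>p. p \<in> T \<Longrightarrow> strict_mono_on A (\<lambda>x. G x p)"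
    and cont: "\<And>x. x \<in> A \<Longrightarrow> continuous_on T (G x)"
    and A: "\<And>x y. x \<in> A \<Longrightarrow> x \<le> y \<Longrightarrow> y \<in> A"
    and w: "\<And>p. p \<in> T \<Longrightarrow> w p \<in> A \<and> G (w p) p = c" and p0: "p0 \<in> T"
  shows "continuous (at p0 within T) w"
  unfolding continuous_within
proof (rule order_tendstoI)
  fix a assume a: "a < w p0"
  show "\<forall>\<^sub>F p in at p0 within T. a < w p"
  proof (cases "a \<in> A")
    case True
    have "G a p0 < c" using mono[OF p0] w[OF p0] True a unfolding strict_mono_on_def by metis
    then have "\<forall>\<^sub>F p in at p0 within T. G a p < c"
      using cont[OF True] p0 unfolding continuous_on_def by (blast intro: order_tendstoD(2))
    moreover have "\<forall>\<^sub>F p in at p0 within T. p \<in> T" by (simp add: eventually_at_filter)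
    ultimately show ?thesis
    proof eventually_elim
      case (elim p)
      show ?case
      proof (rule ccontr)
        assume "\<not> a < w p"
        then have "G (w p) p \<le> G a p"
          using mono[OF elim(2)] w[OF elim(2)] True unfolding strict_mono_on_def
          by (metis antisym_conv2 less_imp_le linorder_le_less_linear order_refl)
        then show False using elim w[OF elim(2)] by auto
      qed
    qed
  next
    case False
    have "\<forall>\<^sub>F p in at p0 within T. p \<in> T" by (simp add: eventually_at_filter)
    then show ?thesis
      by eventually_elim (use False A w in \<open>meson linorder_le_less_linear\<close>)
  qed
next
  fix a assume a: "w p0 < a"
  then have aA: "a \<in> A" using A w[OF p0] by auto
  have "c < G a p0" using mono[OF p0] w[OF p0] aA a unfolding strict_mono_on_def by metis
  then have "\<forall>\<^sub>F p in at p0 within T. c < G a p"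
    using cont[OF aA] p0 unfolding continuous_on_def by (blast intro: order_tendstoD(1))
  moreover have "\<forall>\<^sub>F p in at p0 within T. p \<in> T" by (simp add: eventually_at_filter)
  ultimately show "\<forall>\<^sub>F p in at p0 within T. w p < a"
  proof eventually_elim
    case (elim p)
    show ?case
    proof (rule ccontr)
      assume "\<not> w p < a"
      then have "G a p \<le> G (w p) p"
        using mono[OF elim(2)] w[OF elim(2)] aA unfolding strict_mono_on_def
        by (metis antisym_conv2 less_imp_le linorder_le_less_linear order_refl)
      then show False using elim w[OF elim(2)] by auto
    qed
  qed
qed

lemma growth_surj:
  fixes f :: "real \<Rightarrow> real"
  assumes f: "continuous_on UNIV f" and c: "c > 0"
    and g: "\<And>x y. x \<le> y \<Longrightarrow> c * (y - x) \<le> f y - f x"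
  shows "\<exists>x. f x = u"
proof -
  \<comment> \<open>Over a distance \<open>r\<close> the function changes by at least
    \<open>\<bar>u - f 0\<bar>\<close>, so the values at \<open>-r\<close> and \<open>r\<close>
    enclose \<open>u\<close>.\<close>
  define r where "r = \<bar>u - f 0\<bar> / c"
  have r: "0 \<le> r" "c * r = \<bar>u - f 0\<bar>" using c by (auto simp: r_def)
  have "f (-r) \<le> u" "u \<le> f r" using g[of "-r" 0] g[of 0 r] r by auto
  then show ?thesis
    using IVT'[of f "-r" u r] r continuous_on_subset[OF f, of "{-r..r}"] by auto
qed

text \<open>Only difference quotients to the right of \<open>u\<close> occur, so the bound is
  available at the endpoint of a half-line as well.\<close>

lemma growth_deriv:
  fixes f :: "real \<Rightarrow> real"
  assumes f: "(f has_real_derivative d) (at u within {u..})"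
    and g: "\<And>y. u \<le> y \<Longrightarrow> c * (y - u) \<le> f y - f u"
  shows "c \<le> d"
proof -
  have "((\<lambda>y. (f y - f u) / (y - u)) \<longlongrightarrow> d) (at_right u)"
    using f by (simp add: has_field_derivative_iff at_within_Ici_at_right)
  moreover have "\<forall>\<^sub>F y in at_right u. c \<le> (f y - f u) / (y - u)"
    using eventually_at_right_less[of u] by eventually_elim (use g in \<open>auto simp: field_simps\<close>)
  ultimately show ?thesis by (rule tendsto_lowerbound) simp
qed

text \<open>The growth bound makes the derivative of \<open>F\<close> in its first variable at least
  \<open>c\<close>. The partial derivatives of \<open>w\<close> are then \<open>1 / fu\<close> and
  \<open>- ft / fu\<close> evaluated at \<open>(w, t)\<close>, and induction on \<open>k\<close>
  transfers the smoothness of \<open>fu\<close> and \<open>ft\<close> to them.\<close>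

lemma Ck_implicit:
  assumes F: "Ck k F" and c: "c > 0"
    and g: "\<And>t x y. x \<le> y \<Longrightarrow> c * (y - x) \<le> F y t - F x t"
    and w: "\<And>u t. F (w u t) t = u"
  shows "Ck k w"
proof -
  have mono: "strict_mono_on UNIV (\<lambda>x. F x (snd p) - fst p)" for p :: "real \<times> real"
  proof (rule strict_mono_onI)
    fix x y :: real assume "x < y"
    then have "0 < c * (y - x)" using c by simp
    with g[of x y "snd p"] \<open>x < y\<close> show "F x (snd p) - fst p < F y (snd p) - fst p" by linarith
  qed
  have cont: "continuous_on UNIV (\<lambda>p. F x (snd p) - fst p)" for x
  proof -
    have "continuous_on UNIV (\<lambda>p. F (fst (x, snd p)) (snd (x, snd p)))"
      by (rule continuous_on_compose2[OF Ck_continuous[OF F], where f="\<lambda>p. (x, snd p)"])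
        (auto intro!: continuous_intros)
    then show ?thesis by (auto intro!: continuous_intros)
  qed
  have "continuous (at p) (\<lambda>p. w (fst p) (snd p))" for p
    by (rule continuous_within_implicit[where A=UNIV and T=UNIV and G="\<lambda>x p. F x (snd p) - fst p" and c=0])
      (use mono cont w in auto)
  then have wc: "continuous_on UNIV (\<lambda>p. w (fst p) (snd p))"
    by (simp add: continuous_at_imp_continuous_on)
  show ?thesis
    using F
  proof (induction k)
    case 0
    then show ?case using wc by simp
  next
    case (Suc k)
    obtain fu ft where f: "\<And>u t. has_grad F (fu u t) (ft u t) u t UNIV" "Ck k fu" "Ck k ft"
      using Suc.prems(1) by auto
    have IH: "Ck k w" using Suc.IH Ck_SucD Suc.prems by blast
    have fu: "fu x t > 0" for x t
    proof -
      have "((\<lambda>x. F x t) has_real_derivative fu x t) (at x within {x..})"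
        using has_grad_du[OF f(1)] by simp
      from growth_deriv[OF this, of c] g[of x _ t] c show ?thesis by fastforce
    qed
    have grad: "has_grad w (inverse (fu (w u t) t)) ((-1) * (ft (w u t) t * inverse (fu (w u t) t))) u t UNIV" for u t
    proof -
      \<comment> \<open>The implicit equation is \<open>F w t - u = 0\<close> with the pair
        \<open>(u, t)\<close> as parameter, so \<open>F\<close> is first viewed as a function of
        \<open>(w, (u, t))\<close>.\<close>
      have "((\<lambda>q. (fst q, snd (snd q))) has_derivative (\<lambda>h. (fst h, snd (snd h)))) (at (w u t, u, t))"
        by (auto intro!: derivative_eq_intros)
      from has_derivative_compose[OF this, of "\<lambda>p. F (fst p) (snd p)", simplified, OF f(1)[of "w u t" t]]
      have "((\<lambda>q. F (fst q) (snd (snd q))) has_derivative (\<lambda>h. fu (w u t) t * fst h + ft (w u t) t * snd (snd h)))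
          (at (w u t, u, t))" by auto
      then have "((\<lambda>q. F (fst q) (snd (snd q)) - fst (snd q)) has_derivative
          (\<lambda>h. fu (w u t) t * fst h + (ft (w u t) t * snd (snd h) - fst (snd h)))) (at (w u t, u, t))"
        by (auto intro!: derivative_eq_intros)
      then have "((\<lambda>p. w (fst p) (snd p)) has_derivative
          (\<lambda>k. - (ft (w u t) t * snd k - fst k) / fu (w u t) t)) (at (u, t))"
        by (intro implicit_has_derivative[where F="\<lambda>q. F (fst q) (snd (snd q)) - fst (snd q)" and
              L="\<lambda>k. ft (w u t) t * snd k - fst k" and X=UNIV and c=0])
          (use fu[of "w u t" t] wc w in \<open>auto simp: continuous_on_eq_continuous_within\<close>)
      then show ?thesis
        by (rule has_derivative_eq_rhs) (use fu[of "w u t" t] in \<open>auto simp: field_simps\<close>)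
    qed
    have "Ck k (\<lambda>u t. fu (w u t) t)" "Ck k (\<lambda>u t. ft (w u t) t)"
      using Ck_compose[OF _ IH Ck_snd] f by auto
    moreover from this have "Ck k (\<lambda>u t. inverse (fu (w u t) t))"
      using fu by (intro Ck_inverse) (auto simp: less_imp_neq[symmetric])
    ultimately show ?case
      by (intro Ck_SucI[OF grad] Ck_mult Ck_const)
  qed
qed

section \<open>The triangular system behind Upsilon and the effective speeds\<close>

definition min_system :: "nat \<Rightarrow> (nat \<Rightarrow> real \<Rightarrow> real) \<Rightarrow> real \<Rightarrow> (nat \<Rightarrow> real) \<Rightarrow> bool" where
  "min_system I f u y \<longleftrightarrow> (\<forall>i\<in>{1..I}. y i = u - (\<Sum>j=1..I. 2 * real (min i j) * f j (y j)))"

text \<open>The recursion runs downwards in the index: \<open>Zrec I f k w\<close> is the component with index \<open>I - k\<close> of the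
  solution whose last component is \<open>w\<close>, obtained by subtracting the equations with indices \<open>I\<close> and \<open>I - k\<close>.\<close>

fun Zrec :: "nat \<Rightarrow> (nat \<Rightarrow> real \<Rightarrow> real) \<Rightarrow> nat \<Rightarrow> real \<Rightarrow> real" where
  "Zrec I f k w = w + (\<Sum>m<k. 2 * real (k - m) * f (I - m) (Zrec I f m w))"

declare Zrec.simps [simp del]

text \<open>All coefficients \<open>2 * (k - m)\<close> are nonnegative, so the added sum is
  nondecreasing in \<open>w\<close> and the leading \<open>w\<close> alone supplies growth at rate
  1.\<close>

lemma Zrec_growth:
  assumes f: "\<And>i. i \<in> {1..I} \<Longrightarrow> mono (f i)" and "k \<le> I" and w: "w \<le> w'"
  shows "w' - w \<le> Zrec I f k w' - Zrec I f k w"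
  using \<open>k \<le> I\<close>
proof (induction k rule: less_induct)
  case (less k)
  have "(\<Sum>m<k. 2 * real (k - m) * f (I - m) (Zrec I f m w)) \<le> (\<Sum>m<k. 2 * real (k - m) * f (I - m) (Zrec I f m w'))"
  proof (intro sum_mono mult_left_mono)
    fix m assume m: "m \<in> {..<k}"
    then have "Zrec I f m w \<le> Zrec I f m w'" using less w by force
    moreover have "mono (f (I - m))" using f less.prems m by auto
    ultimately show "f (I - m) (Zrec I f m w) \<le> f (I - m) (Zrec I f m w')" by (rule monoD[rotated])
  qed auto
  then show ?case by (subst (1 2) Zrec.simps) simp
qed

lemma Zrec_continuous:
  assumes f: "\<And>i. i \<in> {1..I} \<Longrightarrow> continuous_on UNIV (f i)" and "k \<le> I"
  shows "continuous_on UNIV (Zrec I f k)"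
  using \<open>k \<le> I\<close>
proof (induction k rule: less_induct)
  case (less k)
  have "continuous_on UNIV (\<lambda>w. f (I - m) (Zrec I f m w))" if "m < k" for m
    using continuous_on_compose2[OF f less.IH, of "I - m" m] that less.prems by auto
  then have "continuous_on UNIV (\<lambda>w. w + (\<Sum>m<k. 2 * real (k - m) * f (I - m) (Zrec I f m w)))"
    by (intro continuous_intros) auto
  then show ?case by (subst Zrec.simps[abs_def])
qed

lemma Ck_Zrec:
  assumes f: "\<And>i. i \<in> {1..I} \<Longrightarrow> Ck n (\<lambda>w t. f t i w)" and "k \<le> I"
  shows "Ck n (\<lambda>w t. Zrec I (f t) k w)"
  using \<open>k \<le> I\<close>
proof (induction k rule: less_induct)
  case (less k)
  have "Ck n (\<lambda>w t. f t (I - m) (Zrec I (f t) m w))" if "m < k" for m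
    using Ck_compose[OF f less.IH Ck_snd, of "I - m" m] that less.prems by auto
  then show ?case by (subst Zrec.simps) (intro Ck_add Ck_fst Ck_sum Ck_mult Ck_const, auto)
qed

text \<open>This is \<open>j = min i j + (j - i)\<close>, with the second term truncated at 0.
  Reindexing by \<open>j = I - m\<close> brings the truncated part into the shape of the sum in
  \<open>Zrec\<close> for \<open>k = I - i\<close>.\<close>

lemma min_sum_split:
  fixes x :: "nat \<Rightarrow> real"
  assumes "i \<le> I"
  shows "(\<Sum>j=1..I. 2 * real j * x j) = (\<Sum>j=1..I. 2 * real (min i j) * x j) + (\<Sum>m<I - i. 2 * real (I - i - m) * x (I - m))"
proof -
  have "(\<Sum>m<I - i. 2 * real (I - i - m) * x (I - m)) = (\<Sum>j\<in>{i<..I}. 2 * real (j - i) * x j)"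
    by (rule sum.reindex_bij_witness[of _ "\<lambda>j. I - j" "\<lambda>m. I - m"]) (use assms in auto)
  also have "\<dots> = (\<Sum>j\<in>{1..I}. 2 * real (j - min i j) * x j)"
    by (rule sum.mono_neutral_cong_left) auto
  finally show ?thesis
    by (simp add: sum.distrib[symmetric] algebra_simps of_nat_diff)
qed

text \<open>Subtracting equation \<open>I\<close> from equation \<open>i\<close> leaves only
  unknowns of larger index on the right, with weights \<open>2 * (j - i)\<close>. What remains is
  one scalar equation for \<open>y I\<close>, which is the formal equation of index 0.\<close>

lemma min_system_iff_Zrec:
  assumes "I \<ge> 1"
  shows "min_system I f u y \<longleftrightarrow> (\<forall>i\<in>{1..I}. y i = Zrec I f (I - i) (y I)) \<and> Zrec I f I (y I) = u"
    (is "?L \<longleftrightarrow> ?R")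
proof -
  have mid: "Zrec I f (I - i) (y I) = y I + ((\<Sum>j=1..I. 2 * real j * f j (y j)) - (\<Sum>j=1..I. 2 * real (min i j) * f j (y j)))"
    if y: "\<And>j. j \<in> {i<..I} \<Longrightarrow> Zrec I f (I - j) (y I) = y j" and i: "i \<le> I" for i
  proof -
    have "Zrec I f m (y I) = y (I - m)" if "m < I - i" for m
      using y[of "I - m"] that by auto
    then have "(\<Sum>m<I-i. 2 * real (I - i - m) * f (I - m) (Zrec I f m (y I))) = (\<Sum>m<I-i. 2 * real (I - i - m) * f (I - m) (y (I - m)))"
      by (intro sum.cong) auto
    then show ?thesis
      by (subst Zrec.simps) (use min_sum_split[of i I "\<lambda>j. f j (y j)"] i in simp)
  qed
  \<comment> \<open>At \<open>i = 0\<close> every \<open>min i j\<close> vanishes; the formal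
    component \<open>y 0\<close> is therefore \<open>u\<close> itself.\<close>
  have top: "Zrec I f I (y I) = y I + (\<Sum>j=1..I. 2 * real j * f j (y j))"
    if "\<And>i. i \<in> {1..I} \<Longrightarrow> Zrec I f (I - i) (y I) = y i"
    using mid[of 0] that by simp
  have yI: "(\<Sum>j=1..I. 2 * real (min I j) * f j (y j)) = (\<Sum>j=1..I. 2 * real j * f j (y j))"
    by (intro sum.cong) auto
  show ?thesis
  proof
    assume L: ?L
    then have eq: "y i = u - (\<Sum>j=1..I. 2 * real (min i j) * f j (y j))" if "i \<in> {1..I}" for i
      using that unfolding min_system_def by blast
    have I: "y I = u - (\<Sum>j=1..I. 2 * real j * f j (y j))"
      using eq[of I] assms yI by simp
    have Z: "i \<in> {1..I} \<Longrightarrow> Zrec I f (I - i) (y I) = y i" for i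
    proof (induction "I - i" arbitrary: i rule: less_induct)
      case less
      have "Zrec I f (I - i) (y I) = y I + ((\<Sum>j=1..I. 2 * real j * f j (y j)) - (\<Sum>j=1..I. 2 * real (min i j) * f j (y j)))"
        using less by (intro mid) auto
      then show ?case using I eq[OF less.prems] by linarith
    qed
    have "Zrec I f I (y I) = u" using top[OF Z] I by linarith
    then show ?R using Z by metis
  next
    assume R: ?R
    then have Z: "Zrec I f (I - i) (y I) = y i" if "i \<in> {1..I}" for i
      using that by metis
    show ?L unfolding min_system_def
    proof
      fix i assume i: "i \<in> {1..I}"
      have "Zrec I f (I - i) (y I) = y I + ((\<Sum>j=1..I. 2 * real j * f j (y j)) - (\<Sum>j=1..I. 2 * real (min i j) * f j (y j)))"
        using i by (intro mid Z) auto
      with Z[OF i] top[OF Z] R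
      show "y i = u - (\<Sum>j=1..I. 2 * real (min i j) * f j (y j))" by linarith
    qed
  qed
qed

text \<open>Monotone nonlinearities make \<open>Zrec I f I\<close> strictly increasing, so
  \<open>u\<close> determines \<open>y I\<close>, and the recursion determines the other
  components.\<close>

lemma min_system_unique:
  assumes I: "I \<ge> 1" and f: "\<And>i. i \<in> {1..I} \<Longrightarrow> mono (f i)"
    and "min_system I f u y" "min_system I f u y'" "i \<in> {1..I}"
  shows "y i = y' i"
proof -
  have "Zrec I f I (y I) = Zrec I f I (y' I)" using assms min_system_iff_Zrec by metis
  then have "y I = y' I"
    using Zrec_growth[of I f I "y I" "y' I", OF f order_refl] Zrec_growth[of I f I "y' I" "y I", OF f order_refl]
    by linarith
  moreover have "y i = Zrec I f (I - i) (y I)" "y' i = Zrec I f (I - i) (y' I)"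
    using assms min_system_iff_Zrec by metis+
  ultimately show ?thesis by metis
qed

lemma min_system_exists:
  assumes I: "I \<ge> 1" and f: "\<And>i. i \<in> {1..I} \<Longrightarrow> mono (f i)" "\<And>i. i \<in> {1..I} \<Longrightarrow> continuous_on UNIV (f i)"
  shows "\<exists>y. min_system I f u y"
proof -
  obtain w where w: "Zrec I f I w = u"
    using growth_surj[of "Zrec I f I" 1 u] Zrec_growth[of I f I] Zrec_continuous[of I f I] f by auto
  define y where "y i = Zrec I f (I - i) w" for i
  have "Zrec I f 0 w = w" by (subst Zrec.simps) simp
  then have "y I = w" by (simp add: y_def)
  then have "min_system I f u y"
    using w by (simp add: min_system_iff_Zrec[OF I] y_def)
  then show ?thesis by blast
qed

section \<open>The effective speeds as a triangular system\<close>

lemma Mmat_sum: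
  assumes "i \<in> {1..I}"
  shows "(\<Sum>j=1..I. Mmat I r i j * v j) =
    v i * (1 - (\<Sum>j=1..I. 2 * real (min i j) * r j)) + (\<Sum>j=1..I. 2 * real (min i j) * r j * v j)"
proof -
  have "(\<Sum>j=1..I. Mmat I r i j * v j) = Mmat I r i i * v i + (\<Sum>j\<in>{1..I}-{i}. 2 * real (min i j) * r j * v j)"
    using assms by (subst sum.remove[of _ i]) (auto simp: Mmat_def intro!: sum.cong)
  also have "\<dots> = v i * (1 - (\<Sum>j\<in>{1..I}-{i}. 2 * real (min i j) * r j)) + (\<Sum>j\<in>{1..I}-{i}. 2 * real (min i j) * r j * v j)"
    by (simp add: Mmat_def)
  \<comment> \<open>Completing both sums by the index \<open>i\<close> adds the same product of
    \<open>2 * i\<close>, \<open>r i\<close> and \<open>v i\<close> once with each sign.\<close>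
  moreover have "(\<Sum>j=1..I. g j) = g i + (\<Sum>j\<in>{1..I}-{i}. g j)" for g :: "nat \<Rightarrow> real"
    using assms by (intro sum.remove) auto
  ultimately show ?thesis
    by (simp only:) (simp add: algebra_simps)
qed

text \<open>If \<open>r j\<close> is the slope of the \<open>j\<close>-th component of the family,
  this is the slope of its \<open>phi\<close> of index \<open>i\<close>. It is also the denominator
  in \<open>dens_set\<close>.\<close>

definition dcoef :: "nat \<Rightarrow> (nat \<Rightarrow> real) \<Rightarrow> nat \<Rightarrow> real" where
  "dcoef I r i = 1 - (\<Sum>j=1..I. 2 * real (min i j) * r j)"

text \<open>Here \<open>v i * dcoef I r i = y i + i\<close> turns \<open>M v = (1, \<dots>, I)\<close> into a system with \<open>u = 0\<close> and the
  nondecreasing affine functions \<open>y \<mapsto> r i / dcoef I r i * (y + i)\<close>.\<close>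

lemma veff_eq_iff_min_system:
  assumes r: "\<And>i. i \<in> {1..I} \<Longrightarrow> 0 < dcoef I r i"
  shows "(\<forall>i\<in>{1..I}. (\<Sum>j=1..I. Mmat I r i j * v j) = real i) \<longleftrightarrow>
    min_system I (\<lambda>i y. r i / dcoef I r i * (y + real i)) 0 (\<lambda>i. v i * dcoef I r i - real i)"
proof -
  have "(\<Sum>j=1..I. 2 * real (min i j) * (r j / dcoef I r j * (v j * dcoef I r j - real j + real j)))
      = (\<Sum>j=1..I. 2 * real (min i j) * r j * v j)" for i
    using r by (intro sum.cong) (auto simp: less_imp_neq[symmetric])
  then show ?thesis
    unfolding min_system_def
    by (intro ball_cong refl) (simp only: Mmat_sum dcoef_def[symmetric], linarith)
qed

text \<open>The affine functions have slopes \<open>r i / dcoef I r i \<ge> 0\<close>, so the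
  results on \<open>min_system\<close> give exactly one solution on the indices \<open>1..I\<close>.
  This turns the description of \<open>veff\<close> by \<open>THE\<close> into the equations
  themselves.\<close>

lemma
  assumes I: "I \<ge> 1" and r: "\<And>i. i \<in> {1..I} \<Longrightarrow> 0 \<le> r i" and d: "\<And>i. i \<in> {1..I} \<Longrightarrow> 0 < dcoef I r i"
  shows veff_system: "i \<in> {1..I} \<Longrightarrow> veff I r i * dcoef I r i + (\<Sum>j=1..I. 2 * real (min i j) * r j * veff I r j) = real i"
    and veff_unique: "(\<And>i. i \<in> {1..I} \<Longrightarrow> v i * dcoef I r i + (\<Sum>j=1..I. 2 * real (min i j) * r j * v j) = real i)
       \<Longrightarrow> i \<in> {1..I} \<Longrightarrow> veff I r i = v i"
proof -
  let ?P = "\<lambda>v. \<forall>i\<in>{1..I}. (\<Sum>j=1..I. Mmat I r i j * v j) = real i"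
  let ?f = "\<lambda>i y. r i / dcoef I r i * (y + real i)"
  have d0: "\<And>i. i \<in> {1..I} \<Longrightarrow> dcoef I r i \<noteq> 0" using d by force
  have mono: "mono (?f i)" if "i \<in> {1..I}" for i
    by (intro monoI mult_left_mono) (use r[OF that] d[OF that] in auto)
  have "\<exists>y. min_system I ?f 0 y"
    by (rule min_system_exists[OF I mono]) (use d0 in \<open>auto intro!: continuous_intros\<close>)
  then obtain y where y: "min_system I ?f 0 y" by blast
  \<comment> \<open>The value 0 outside \<open>1..I\<close> is the normalisation in
    \<open>veff\<close>, without which the description would not single out one function.\<close>
  define v0 where "v0 i = (if i \<in> {1..I} then (y i + real i) / dcoef I r i else 0)" for i
  have "min_system I ?f 0 (\<lambda>i. v0 i * dcoef I r i - real i)"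
  proof -
    have "v0 i * dcoef I r i - real i = y i" if "i \<in> {1..I}" for i
      using d0[OF that] that by (simp add: v0_def)
    then show ?thesis using y unfolding min_system_def by (auto intro!: sum.cong)
  qed
  then have P0: "?P v0" using veff_eq_iff_min_system d by blast
  have uniq: "v i = v' i" if "?P v" "?P v'" "i \<in> {1..I}" for v v' i
  proof -
    have "v i * dcoef I r i - real i = v' i * dcoef I r i - real i"
      by (rule min_system_unique[OF I mono]) (use that veff_eq_iff_min_system d in blast)+
    then show ?thesis using d0[OF that(3)] by simp
  qed
  have veff: "?P (veff I r) \<and> (\<forall>j. j \<notin> {1..I} \<longrightarrow> veff I r j = 0)"
    unfolding veff_def
  proof (rule theI[of _ v0])
    show "?P v0 \<and> (\<forall>j. j \<notin> {1..I} \<longrightarrow> v0 j = 0)" using P0 by (auto simp: v0_def)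
    fix v assume "?P v \<and> (\<forall>j. j \<notin> {1..I} \<longrightarrow> v j = 0)"
    then show "v = v0" using uniq[OF _ P0] by (intro ext) (metis v0_def)
  qed
  show "i \<in> {1..I} \<Longrightarrow> veff I r i * dcoef I r i + (\<Sum>j=1..I. 2 * real (min i j) * r j * veff I r j) = real i"
    using veff Mmat_sum[of i I r "veff I r"] by (simp add: dcoef_def)
  assume "\<And>i. i \<in> {1..I} \<Longrightarrow> v i * dcoef I r i + (\<Sum>j=1..I. 2 * real (min i j) * r j * v j) = real i" "i \<in> {1..I}"
  then show "veff I r i = v i"
    using veff uniq[of "veff I r" v i] Mmat_sum[of _ I r v] by (simp add: dcoef_def)
qed

lemma veff_cong:
  assumes "\<And>j. j \<in> {1..I} \<Longrightarrow> r j = r' j"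
  shows "veff I r = veff I r'"
proof -
  have "Mmat I r i j = Mmat I r' i j" if "j \<in> {1..I}" for i j
    using assms that by (auto simp: Mmat_def intro!: sum.cong)
  then have "(\<Sum>j=1..I. Mmat I r i j * v j) = (\<Sum>j=1..I. Mmat I r' i j * v j)" for i v
    by (intro sum.cong) auto
  then show ?thesis unfolding veff_def by presburger
qed

section \<open>The class D and its profiles\<close>

text \<open>A form of membership in D with explicit constants \<open>L\<close> in place of suprema,
  and with increments in place of quotients. It is equivalent to \<open>inD\<close> for
  \<open>I \<ge> 1\<close> up to the choice of \<open>L\<close>, by \<open>D_bound_imp_inD\<close>
  and \<open>inD_imp_D_bound\<close>.\<close>

definition D_bound :: "nat \<Rightarrow> (nat \<Rightarrow> real \<Rightarrow> real) \<Rightarrow> (nat \<Rightarrow> real) \<Rightarrow> bool" where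
  "D_bound I \<psi> L \<longleftrightarrow> (\<forall>i\<in>{1..I}. Cc (\<psi> i)) \<and> strict_mono_on {0..} (phi I \<psi> I) \<and>
     (\<forall>i\<in>{1..I}. 0 \<le> L i \<and> (\<forall>x y. 0 \<le> x \<longrightarrow> x \<le> y \<longrightarrow> \<psi> i y - \<psi> i x \<le> L i * (phi I \<psi> i y - phi I \<psi> i x))) \<and>
     (\<Sum>i=1..I. real i * L i) < 1/2"

lemma phi_0: "(\<And>i. i \<in> {1..I} \<Longrightarrow> \<psi> i 0 = 0) \<Longrightarrow> phi I \<psi> i 0 = 0"
  by (simp add: phi_def)

lemma phi_diff: "phi I \<psi> i y - phi I \<psi> i x = (y - x) - (\<Sum>j=1..I. 2 * real (min i j) * (\<psi> j y - \<psi> j x))"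
  by (simp add: phi_def sum_subtractf right_diff_distrib)

lemma phi_mono_index:
  assumes "\<And>i. i \<in> {1..I} \<Longrightarrow> mono_on {0..} (\<psi> i)" "0 \<le> x" "x \<le> y" "i \<in> {1..I}"
  shows "phi I \<psi> I y - phi I \<psi> I x \<le> phi I \<psi> i y - phi I \<psi> i x"
proof -
  have "(\<Sum>j=1..I. 2 * real (min i j) * (\<psi> j y - \<psi> j x)) \<le> (\<Sum>j=1..I. 2 * real (min I j) * (\<psi> j y - \<psi> j x))"
    using assms by (intro sum_mono mult_right_mono) (auto simp: mono_on_def)
  then show ?thesis unfolding phi_diff by linarith
qed

lemma phi_diff_le:
  assumes "\<And>i. i \<in> {1..I} \<Longrightarrow> mono_on {0..} (\<psi> i)" "0 \<le> x" "x \<le> y"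
  shows "phi I \<psi> i y - phi I \<psi> i x \<le> y - x"
proof -
  have "0 \<le> (\<Sum>j=1..I. 2 * real (min i j) * (\<psi> j y - \<psi> j x))"
    using assms by (intro sum_nonneg mult_nonneg_nonneg) (auto simp: mono_on_def)
  then show ?thesis unfolding phi_diff by linarith
qed

context
  fixes I \<psi> L assumes D: "D_bound I \<psi> L"
begin

lemma D_bound_Cc: "i \<in> {1..I} \<Longrightarrow> Cc (\<psi> i)"
  and D_bound_nonneg: "i \<in> {1..I} \<Longrightarrow> 0 \<le> L i"
  and D_bound_le: "i \<in> {1..I} \<Longrightarrow> 0 \<le> x \<Longrightarrow> x \<le> y \<Longrightarrow> \<psi> i y - \<psi> i x \<le> L i * (phi I \<psi> i y - phi I \<psi> i x)"
  and D_bound_sum: "0 < 1 - 2 * (\<Sum>i=1..I. real i * L i)"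
  using D unfolding D_bound_def by auto

lemma D_bound_mono: "i \<in> {1..I} \<Longrightarrow> mono_on {0..} (\<psi> i)"
  using D_bound_Cc by (auto simp: Cc_def)

text \<open>Each \<open>phi\<close> has slope at most 1, so the increment of \<open>\<psi> j\<close>
  is at most \<open>L j * (y - x)\<close>. Summing these with weights
  \<open>2 * min i j \<le> 2 * j\<close> leaves a positive lower slope, the same for all
  \<open>i\<close>.\<close>

lemma D_bound_growth:
  assumes i: "i \<in> {1..I}" and xy: "0 \<le> x" "x \<le> y"
  shows "(1 - 2 * (\<Sum>i=1..I. real i * L i)) * (y - x) \<le> phi I \<psi> i y - phi I \<psi> i x"
proof -
  have "(\<Sum>j=1..I. 2 * real (min i j) * (\<psi> j y - \<psi> j x)) \<le> (\<Sum>j=1..I. 2 * real j * (L j * (y - x)))"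
  proof (intro sum_mono)
    fix j assume j: "j \<in> {1..I}"
    have "\<psi> j y - \<psi> j x \<le> L j * (phi I \<psi> j y - phi I \<psi> j x)" using D_bound_le j xy by blast
    also have "\<dots> \<le> L j * (y - x)"
      using D_bound_nonneg[OF j] phi_diff_le[OF D_bound_mono xy] by (intro mult_left_mono) auto
    finally have *: "\<psi> j y - \<psi> j x \<le> L j * (y - x)" .
    have "0 \<le> \<psi> j y - \<psi> j x" using D_bound_mono[OF j] xy by (auto simp: mono_on_def)
    then have "2 * real (min i j) * (\<psi> j y - \<psi> j x) \<le> 2 * real j * (\<psi> j y - \<psi> j x)"
      by (intro mult_right_mono) auto
    also have "\<dots> \<le> 2 * real j * (L j * (y - x))" using * by (intro mult_left_mono) auto
    finally show "2 * real (min i j) * (\<psi> j y - \<psi> j x) \<le> 2 * real j * (L j * (y - x))" .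
  qed
  also have "\<dots> = 2 * (\<Sum>i=1..I. real i * L i) * (y - x)"
    by (simp add: sum_distrib_left sum_distrib_right algebra_simps)
  finally show ?thesis unfolding phi_diff by (simp add: algebra_simps)
qed

lemma D_bound_Cup:
  assumes i: "i \<in> {1..I}"
  shows "Cup (phi I \<psi> i)"
proof -
  let ?c = "1 - 2 * (\<Sum>i=1..I. real i * L i)"
  have z: "phi I \<psi> i 0 = 0" by (rule phi_0) (use D_bound_Cc in \<open>auto simp: Cc_def\<close>)
  have "continuous_on {0..} (phi I \<psi> i)"
    unfolding phi_def[abs_def] using D_bound_Cc by (auto intro!: continuous_intros simp: Cc_def)
  moreover have st: "strict_mono_on {0..} (phi I \<psi> i)"
  proof (rule strict_mono_onI)
    fix x y :: real assume "x \<in> {0..}" "y \<in> {0..}" "x < y"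
    moreover from this have "0 < ?c * (y - x)" using D_bound_sum by simp
    ultimately show "phi I \<psi> i x < phi I \<psi> i y" using D_bound_growth[OF i, of x y] by force
  qed
  moreover have "mono_on {0..} (phi I \<psi> i)" using st by (rule strict_mono_on_imp_mono_on)
  moreover have "\<forall>u\<ge>0. 0 \<le> phi I \<psi> i u"
    using \<open>mono_on {0..} (phi I \<psi> i)\<close> z unfolding mono_on_def by (metis atLeast_iff order_refl)
  moreover have "filterlim (phi I \<psi> i) at_top at_top"
  proof (rule filterlim_at_top_mono)
    show "filterlim (\<lambda>u. ?c * u) at_top at_top"
      using D_bound_sum by (rule filterlim_tendsto_pos_mult_at_top[OF tendsto_const _ filterlim_ident])
    show "\<forall>\<^sub>F u in at_top. ?c * u \<le> phi I \<psi> i u"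
      using eventually_ge_at_top[of 0] by eventually_elim (use D_bound_growth[OF i, of 0] z in auto)
  qed
  ultimately show ?thesis using z unfolding Cup_def Cc_def by blast
qed

end

lemma Cup_inj_on: "Cup f \<Longrightarrow> inj_on f {0..}"
  unfolding Cup_def by (meson strict_mono_on_imp_inj_on)

lemma Cup_surj:
  assumes "Cup f" "0 \<le> z"
  shows "\<exists>u\<ge>0. f u = z"
proof -
  have "\<forall>\<^sub>F u in at_top. z \<le> f u \<and> 0 \<le> u"
    using assms eventually_ge_at_top[of 0] unfolding Cup_def filterlim_at_top by (intro eventually_conj) auto
  then obtain b where b: "z \<le> f b" "0 \<le> b"
    using eventually_happens'[OF trivial_limit_at_top_linorder] by blast
  have f: "continuous_on {0..b} f" "f 0 = 0"
    using assms continuous_on_subset[of "{0..}" f "{0..b}"] unfolding Cup_def Cc_def by auto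
  obtain u where "0 \<le> u" "f u = z"
    using IVT'[of f 0 z b] f b assms(2) by auto
  then show ?thesis by blast
qed

lemma Ups_phi:
  assumes "Cup (phi I \<psi> i)" "0 \<le> u"
  shows "Ups I \<psi> i (phi I \<psi> i u) = \<psi> i u"
  using the_inv_into_f_f[OF Cup_inj_on[OF assms(1)], of u] assms by (simp add: Ups_def)

lemma D_bound_ratio:
  assumes D: "D_bound I \<psi> L" and i: "i \<in> {1..I}" and r: "r \<in> ratio_set I \<psi> i"
  shows "r \<le> L i"
proof -
  have *: "(\<psi> i y - \<psi> i x) / (phi I \<psi> i y - phi I \<psi> i x) \<le> L i" if "0 \<le> x" "x < y" for x y
  proof -
    have "phi I \<psi> i x < phi I \<psi> i y"
      using D_bound_Cup[OF D i] that unfolding Cup_def strict_mono_on_def by auto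
    then show ?thesis using D_bound_le[OF D i, of x y] that by (simp add: divide_le_eq)
  qed
  obtain u1 u2 where u: "0 \<le> u1" "0 \<le> u2" "u1 \<noteq> u2"
    "r = (\<psi> i u1 - \<psi> i u2) / (phi I \<psi> i u1 - phi I \<psi> i u2)" using r unfolding ratio_set_def by blast
  have "r = (\<psi> i u2 - \<psi> i u1) / (phi I \<psi> i u2 - phi I \<psi> i u1)"
    unfolding u(4) by (metis minus_diff_eq minus_divide_divide)
  then show ?thesis using *[of u1 u2] *[of u2 u1] u by linarith
qed

lemma ratio_set_ne: "ratio_set I \<psi> i \<noteq> {}"
  unfolding ratio_set_def using zero_neq_one[where 'a=real] zero_le_one[where 'a=real] by blast

lemma D_bound_imp_inD:
  assumes D: "D_bound I \<psi> L" and I: "I \<ge> 1"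
  shows "inD I \<psi>"
proof -
  have b: "bdd_above (ratio_set I \<psi> i)" if "i \<in> {1..I}" for i
    using D_bound_ratio[OF D that] by (auto simp: bdd_above_def)
  have "(\<Sum>i=1..I. real i * Sup (ratio_set I \<psi> i)) \<le> (\<Sum>i=1..I. real i * L i)"
    using D_bound_ratio[OF D] ratio_set_ne by (intro sum_mono mult_left_mono cSup_least) auto
  then show ?thesis
    using b D_bound_Cc[OF D] D_bound_Cup[OF D, of I] D_bound_sum[OF D] I unfolding inD_def by auto
qed

text \<open>Among all indices \<open>phi I \<psi> I\<close> has the smallest increments, so its
  strict monotonicity makes every denominator in \<open>ratio_set\<close> positive. The quotients
  can then be cleared.\<close>

lemma inD_imp_D_bound:
  assumes D: "inD I \<psi>"
  shows "D_bound I \<psi> (\<lambda>i. Sup (ratio_set I \<psi> i))"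
proof -
  have Cc: "Cc (\<psi> i)" if "i \<in> {1..I}" for i using D that unfolding inD_def by auto
  then have m: "mono_on {0..} (\<psi> i)" if "i \<in> {1..I}" for i using that by (auto simp: Cc_def)
  have st: "strict_mono_on {0..} (phi I \<psi> I)" using D unfolding inD_def Cup_def by auto
  have pos: "0 < phi I \<psi> i y - phi I \<psi> i x" if "i \<in> {1..I}" "0 \<le> x" "x < y" for i x y
  proof -
    have "0 < phi I \<psi> I y - phi I \<psi> I x" using st that by (auto simp: strict_mono_on_def)
    also have "\<dots> \<le> phi I \<psi> i y - phi I \<psi> i x" by (rule phi_mono_index[OF m]) (use that in auto)
    finally show ?thesis .
  qed
  have le: "(\<psi> i y - \<psi> i x) / (phi I \<psi> i y - phi I \<psi> i x) \<le> Sup (ratio_set I \<psi> i)"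
    if "i \<in> {1..I}" "0 \<le> x" "x < y" for i x y
  proof (rule cSup_upper)
    show "(\<psi> i y - \<psi> i x) / (phi I \<psi> i y - phi I \<psi> i x) \<in> ratio_set I \<psi> i"
      unfolding ratio_set_def by (rule CollectI, rule exI[of _ y], rule exI[of _ x]) (use that in auto)
    show "bdd_above (ratio_set I \<psi> i)" using D that unfolding inD_def by auto
  qed
  have "0 \<le> Sup (ratio_set I \<psi> i)" if i: "i \<in> {1..I}" for i
  proof -
    have "0 \<le> (\<psi> i 1 - \<psi> i 0) / (phi I \<psi> i 1 - phi I \<psi> i 0)"
      using pos[OF i, of 0 1] m[OF i] by (intro divide_nonneg_nonneg) (auto simp: mono_on_def)
    then show ?thesis using le[OF i, of 0 1] by linarith
  qed
  moreover have "\<psi> i y - \<psi> i x \<le> Sup (ratio_set I \<psi> i) * (phi I \<psi> i y - phi I \<psi> i x)"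
    if "i \<in> {1..I}" "0 \<le> x" "x \<le> y" for i x y
    using le[of i x y] pos[of i x y] that by (cases "x = y") (auto simp: pos_divide_le_eq)
  ultimately show ?thesis
    unfolding D_bound_def using Cc st D by (auto simp: inD_def)
qed

section \<open>Extension by zero and the profile of an element of D\<close>

abbreviation ext0 :: "(real \<Rightarrow> real) \<Rightarrow> real \<Rightarrow> real" where
  "ext0 f \<equiv> (\<lambda>x. if x < 0 then 0 else f x)"

lemma Ck_continuous_fst:
  assumes "Ck k g"
  shows "continuous_on UNIV (\<lambda>x. g x t)"
proof -
  have "continuous_on UNIV (\<lambda>x. g (fst (x, t)) (snd (x, t)))"
    by (rule continuous_on_compose2[OF Ck_continuous[OF assms]]) (auto intro!: continuous_intros)
  then show ?thesis by simp
qed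

lemma Ck_1_fst_iff:
  "Ck 1 (\<lambda>x t. f x) \<longleftrightarrow> f C1_differentiable_on UNIV"
proof
  assume "Ck 1 (\<lambda>x t. f x)"
  then obtain fu ft where f: "\<And>u t. has_grad (\<lambda>x t. f x) (fu u t) (ft u t) u t UNIV" "Ck 0 fu"
    by (auto simp: One_nat_def)
  have "(f has_real_derivative fu x 0) (at x)" for x using has_grad_du[OF f(1)[of x 0], of UNIV] by simp
  moreover have "continuous_on UNIV (\<lambda>x. fu x 0)"
    using f(2) by (rule Ck_continuous_fst)
  ultimately show "f C1_differentiable_on UNIV"
    unfolding C1_differentiable_on_def has_real_derivative_iff_has_vector_derivative
    by (intro exI[of _ "\<lambda>x. fu x 0"]) auto
next
  assume "f C1_differentiable_on UNIV"
  then obtain f' where f: "\<And>x. (f has_real_derivative f' x) (at x)" "continuous_on UNIV f'"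
    unfolding C1_differentiable_on_def has_real_derivative_iff_has_vector_derivative by blast
  have "continuous_on UNIV (\<lambda>p::real \<times> real. f' (fst p))"
    by (intro continuous_on_compose2[OF f(2)] continuous_intros) auto
  then show "Ck 1 (\<lambda>x t. f x)" using Ck_Suc_fst[OF f(1), of 0] by simp
qed

lemma C1plus_iff: "C1plus f \<longleftrightarrow> Ck 1 (\<lambda>x t. ext0 f x) \<and> (\<forall>u\<ge>0. 0 \<le> f u)"
  unfolding C1plus_def Ck_1_fst_iff ..

text \<open>The profile is \<open>\<psi> i\<close> composed with the inverse of
  \<open>phi I \<psi> i\<close>, that is, \<open>Ups I \<psi> i\<close> continued by 0 to the
  negative axis. Working with extensions on the whole line makes it exactly as smooth as the
  functions \<open>ext0 (\<psi> j)\<close>.\<close>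

lemma profile_exists:
  assumes D: "D_bound I \<psi> L" and k: "\<And>i. i \<in> {1..I} \<Longrightarrow> Ck k (\<lambda>x t. ext0 (\<psi> i) x)" and i: "i \<in> {1..I}"
  shows "\<exists>E. Ck k (\<lambda>z t. E z) \<and> (\<forall>z\<le>0. E z = 0) \<and> mono E \<and>
    (\<forall>x y. x \<le> y \<longrightarrow> E y - E x \<le> L i * (y - x)) \<and> (\<forall>u\<ge>0. E (phi I \<psi> i u) = \<psi> i u)"
proof -
  define c where "c = 1 - 2 * (\<Sum>i=1..I. real i * L i)"
  have z: "\<psi> j 0 = 0" if "j \<in> {1..I}" for j using D_bound_Cc[OF D that] by (simp add: Cc_def)
  have ext: "ext0 (\<psi> j) x = \<psi> j (max x 0)" if "j \<in> {1..I}" for j x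
    using z[OF that] by (auto simp: max_def)
  \<comment> \<open>On the negative axis all extended functions vanish, so \<open>P\<close> is the
    identity there and becomes an increasing bijection of the line.\<close>
  define P where "P x = phi I (\<lambda>j. ext0 (\<psi> j)) i x" for x
  have P: "P x = phi I \<psi> i (max x 0) + min x 0" for x
  proof -
    have "(\<Sum>j=1..I. 2 * real (min i j) * ext0 (\<psi> j) x) = (\<Sum>j=1..I. 2 * real (min i j) * \<psi> j (max x 0))"
      using ext by (intro sum.cong) auto
    then show ?thesis by (auto simp: P_def phi_def max_def min_def)
  qed
  \<comment> \<open>The bound \<open>c \<le> 1\<close> is what the negative half-line requires,
    since the slope of \<open>P\<close> there is 1.\<close>
  have c: "0 < c" "c \<le> 1" unfolding c_def
    using D_bound_sum[OF D] D_bound_nonneg[OF D] by (auto intro!: sum_nonneg)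
  have growth: "c * (y - x) \<le> P y - P x" if "x \<le> y" for x y
  proof -
    have "c * (max y 0 - max x 0) \<le> phi I \<psi> i (max y 0) - phi I \<psi> i (max x 0)"
      unfolding c_def by (rule D_bound_growth[OF D i]) (use that in auto)
    moreover have "c * (min y 0 - min x 0) \<le> 1 * (min y 0 - min x 0)"
      using c that by (intro mult_right_mono) auto
    moreover have "c * (y - x) = c * (max y 0 - max x 0) + c * (min y 0 - min x 0)"
      unfolding distrib_left[symmetric] by (rule arg_cong[where f="(*) c"]) (auto simp: max_def min_def)
    ultimately show ?thesis unfolding P by argo
  qed
  have CkP: "Ck k (\<lambda>x t. P x)"
    unfolding P_def phi_def by (intro Ck_diff Ck_fst Ck_sum Ck_mult Ck_const k)
  have "continuous_on UNIV P"
    using CkP by (rule Ck_continuous_fst)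
  from growth_surj[OF this c(1) growth] obtain \<eta> where \<eta>: "\<And>z. P (\<eta> z) = z" by metis
  have Ck\<eta>: "Ck k (\<lambda>z t. \<eta> z)"
    by (rule Ck_implicit[OF CkP c(1)]) (use growth \<eta> in auto)
  have strict: "P x < P y" if "x < y" for x y
  proof -
    have "0 < c * (y - x)" using c that by simp
    then show ?thesis using growth[of x y] that by linarith
  qed
  have \<eta>m: "\<eta> x \<le> \<eta> y" if "x \<le> y" for x y
    using strict[of "\<eta> y" "\<eta> x"] \<eta> that by (metis linorder_not_le)
  have P0: "P 0 = 0" using phi_0[of I \<psi> i] z by (simp add: P)
  define E where "E x = \<psi> i (max (\<eta> x) 0)" for x
  have E: "E x = ext0 (\<psi> i) (\<eta> x)" for x using ext[OF i] by (simp add: E_def)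
  have "Ck k (\<lambda>z t. E z)" unfolding E by (rule Ck_compose[OF k[OF i] Ck\<eta> Ck_snd])
  moreover have "E x = 0" if "x \<le> 0" for x
  proof -
    have "\<eta> x \<le> 0" using strict[of 0 "\<eta> x"] P0 \<eta>[of x] that by linarith
    then show ?thesis using z[OF i] by (simp add: E_def max_def)
  qed
  moreover have "mono E"
  proof (rule monoI)
    fix x y :: real assume "x \<le> y"
    then have "max (\<eta> x) 0 \<le> max (\<eta> y) 0" using \<eta>m[of x y] by auto
    then show "E x \<le> E y" using D_bound_mono[OF D i] by (auto simp: E_def mono_on_def)
  qed
  moreover have "E y - E x \<le> L i * (y - x)" if "x \<le> y" for x y
  proof -
    have "E y - E x \<le> L i * (phi I \<psi> i (max (\<eta> y) 0) - phi I \<psi> i (max (\<eta> x) 0))"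
      unfolding E_def by (rule D_bound_le[OF D i]) (use \<eta>m[OF that] in auto)
    also have "\<dots> \<le> L i * (P (\<eta> y) - P (\<eta> x))"
      using D_bound_nonneg[OF D i] \<eta>m[OF that] by (intro mult_left_mono) (auto simp: P)
    finally show ?thesis by (simp add: \<eta>)
  qed
  moreover have "E (phi I \<psi> i u) = \<psi> i u" if "0 \<le> u" for u
  proof -
    have Pu: "P u = phi I \<psi> i u" using that by (simp add: P)
    have "\<eta> (P u) = u" using strict \<eta> by (metis linorder_cases order_less_irrefl)
    then show ?thesis using that by (simp add: E_def Pu)
  qed
  ultimately show ?thesis by blast
qed

section \<open>The flow of a profile\<close>

lemma phi_deriv:
  assumes "\<And>j. j \<in> {1..I} \<Longrightarrow> (\<psi> j has_real_derivative r j) (at u within S)"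
  shows "(phi I \<psi> i has_real_derivative dcoef I r i) (at u within S)"
proof -
  have "((\<lambda>u. u - (\<Sum>j=1..I. 2 * real (min i j) * \<psi> j u)) has_real_derivative dcoef I r i) (at u within S)"
    unfolding dcoef_def by (intro DERIV_diff DERIV_ident DERIV_sum DERIV_cmult assms)
  then show ?thesis by (simp add: phi_def[abs_def])
qed

text \<open>The bounds come from \<open>growth_deriv\<close> applied to \<open>\<psi> i\<close>, to
  \<open>phi I \<psi> i\<close> and to \<open>L i * phi I \<psi> i - \<psi> i\<close>.\<close>

lemma
  assumes D: "D_bound I \<psi> L" and u: "0 \<le> u"
    and r: "\<And>j. j \<in> {1..I} \<Longrightarrow> (\<psi> j has_real_derivative r j) (at u within {0..})" and i: "i \<in> {1..I}"
  shows D_bound_deriv_nonneg: "0 \<le> r i"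
    and D_bound_dcoef_pos: "0 < dcoef I r i"
    and D_bound_deriv_le: "r i \<le> L i * dcoef I r i"
proof -
  have r': "(\<psi> j has_real_derivative r j) (at u within {u..})" if "j \<in> {1..I}" for j
    by (rule DERIV_subset[OF r[OF that]]) (use u in auto)
  note p = phi_deriv[OF r', of I]
  show "0 \<le> r i"
    by (rule growth_deriv[OF r'[OF i]]) (use D_bound_mono[OF D i] u in \<open>auto simp: mono_on_def\<close>)
  have "1 - 2 * (\<Sum>i=1..I. real i * L i) \<le> dcoef I r i"
    by (rule growth_deriv[OF p]) (use D_bound_growth[OF D i] u in auto)
  then show "0 < dcoef I r i" using D_bound_sum[OF D] by linarith
  have "((\<lambda>x. L i * phi I \<psi> i x - \<psi> i x) has_real_derivative L i * dcoef I r i - r i) (at u within {u..})"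
    by (intro DERIV_diff DERIV_cmult p r' i)
  then have "0 \<le> L i * dcoef I r i - r i"
    by (rule growth_deriv) (use D_bound_le[OF D i, of u] u in \<open>auto simp: algebra_simps\<close>)
  then show "r i \<le> L i * dcoef I r i" by simp
qed

text \<open>The regularity is \<open>Suc k\<close> so that first derivatives are of class
  \<open>Ck k\<close>. Part (a) uses \<open>k = 0\<close> and part (b) uses
  \<open>k = 1\<close>.\<close>

locale profile =
  fixes I :: nat and L :: "nat \<Rightarrow> real" and E :: "nat \<Rightarrow> real \<Rightarrow> real" and k :: nat
  assumes I: "I \<ge> 1" and L_nonneg: "i \<in> {1..I} \<Longrightarrow> 0 \<le> L i" and L_sum: "(\<Sum>i=1..I. real i * L i) < 1/2"
    and Ck_E: "i \<in> {1..I} \<Longrightarrow> Ck (Suc k) (\<lambda>z t. E i z)"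
    and E_zero: "i \<in> {1..I} \<Longrightarrow> z \<le> 0 \<Longrightarrow> E i z = 0"
    and E_mono: "i \<in> {1..I} \<Longrightarrow> mono (E i)"
    and E_Lip: "i \<in> {1..I} \<Longrightarrow> x \<le> y \<Longrightarrow> E i y - E i x \<le> L i * (y - x)"
begin

definition shifted :: "real \<Rightarrow> nat \<Rightarrow> real \<Rightarrow> real" where
  "shifted t i z = E i (z - real i * t)"

text \<open>The last component of the solution as a function of \<open>(u, t)\<close>; by
  \<open>Z_growth\<close> the chosen root is the only one.\<close>

definition W :: "real \<Rightarrow> real \<Rightarrow> real" where
  "W u t = (SOME w. Zrec I (shifted t) I w = u)"

definition Y :: "nat \<Rightarrow> real \<Rightarrow> real \<Rightarrow> real" where
  "Y i u t = Zrec I (shifted t) (I - i) (W u t)"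

text \<open>The candidate for the flow. It is defined for negative \<open>u\<close> and
  \<open>t\<close> too, so its smoothness can be established without boundary
  considerations.\<close>

definition X :: "nat \<Rightarrow> real \<Rightarrow> real \<Rightarrow> real" where
  "X i u t = E i (Y i u t - real i * t)"

lemma shifted_mono: "i \<in> {1..I} \<Longrightarrow> mono (shifted t i)"
  unfolding shifted_def by (intro monoI monoD[OF E_mono]) auto

lemma Ck_shift: "Ck (Suc k) Z \<Longrightarrow> i \<in> {1..I} \<Longrightarrow> Ck (Suc k) (\<lambda>z t. E i (Z z t - real i * t))"
  by (intro Ck_compose[OF Ck_E] Ck_diff Ck_mult Ck_const Ck_snd) auto

lemma Ck_Z: "m \<le> I \<Longrightarrow> Ck (Suc k) (\<lambda>w t. Zrec I (shifted t) m w)"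
  unfolding shifted_def by (intro Ck_Zrec Ck_shift Ck_fst)

lemma Z_growth: "m \<le> I \<Longrightarrow> x \<le> y \<Longrightarrow> y - x \<le> Zrec I (shifted t) m y - Zrec I (shifted t) m x"
  by (intro Zrec_growth shifted_mono)

lemma Z_W: "Zrec I (shifted t) I (W u t) = u"
proof -
  have "\<exists>w. Zrec I (shifted t) I w = u"
    by (rule growth_surj[of _ 1]) (use Z_growth[of I] Ck_continuous_fst[OF Ck_Z[of I]] in auto)
  then show ?thesis unfolding W_def by (rule someI_ex)
qed

lemma Ck_W: "Ck (Suc k) W"
  by (rule Ck_implicit[OF Ck_Z[of I], of 1]) (use Z_growth[of I] Z_W in auto)

lemma Ck_Y: "Ck (Suc k) (Y i)"
  unfolding Y_def[abs_def] using Ck_compose[OF Ck_Z[of "I - i"] Ck_W Ck_snd] by simp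

lemma Ck_X: "i \<in> {1..I} \<Longrightarrow> Ck (Suc k) (X i)"
  unfolding X_def[abs_def] by (intro Ck_shift Ck_Y)

lemma Y_system: "min_system I (shifted t) u (\<lambda>i. Y i u t)"
proof -
  have "Y I u t = W u t" unfolding Y_def by (subst Zrec.simps) simp
  then show ?thesis
    using Z_W by (simp add: min_system_iff_Zrec[OF I] Y_def)
qed

lemma Y_eq: "i \<in> {1..I} \<Longrightarrow> Y i u t = u - (\<Sum>j=1..I. 2 * real (min i j) * X j u t)"
  using Y_system[of t u] unfolding min_system_def shifted_def X_def by blast

lemma Y_eq_phi: "i \<in> {1..I} \<Longrightarrow> Y i u t = phi I (\<lambda>j x. X j x t) i u"
  by (simp add: Y_eq phi_def)

text \<open>Uniqueness at a single point \<open>(u, t)\<close>: any numbers \<open>p i\<close>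
  solving the system are the values of \<open>X\<close>. This identifies \<open>X\<close> with the
  image under \<open>Ups_inv\<close>, with the initial data at time 0, and with an arbitrary
  solution of the transport equation.\<close>

lemma X_unique:
  assumes p: "\<And>i. i \<in> {1..I} \<Longrightarrow> p i = E i ((u - (\<Sum>j=1..I. 2 * real (min i j) * p j)) - real i * t)"
    and i: "i \<in> {1..I}"
  shows "p i = X i u t"
proof -
  define y where "y i = u - (\<Sum>j=1..I. 2 * real (min i j) * p j)" for i
  have py: "p i = shifted t i (y i)" if "i \<in> {1..I}" for i
    using p[OF that] by (simp add: shifted_def y_def)
  have "(\<Sum>j=1..I. 2 * real (min i j) * shifted t j (y j)) = (\<Sum>j=1..I. 2 * real (min i j) * p j)" for i
    using py by (intro sum.cong) auto
  then have "min_system I (shifted t) u y" unfolding min_system_def by (simp add: y_def)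
  from min_system_unique[OF I shifted_mono this Y_system i]
  show ?thesis using py[OF i] by (simp add: X_def shifted_def)
qed

text \<open>Here the zero vector solves the system, because every profile is evaluated at a
  nonpositive argument.\<close>

lemma X_zero:
  assumes "u \<le> 0" "0 \<le> t" "i \<in> {1..I}"
  shows "X i u t = 0"
proof -
  have "0 = X i u t"
  proof (rule X_unique[where p="\<lambda>_. 0"])
    fix j assume j: "j \<in> {1..I}"
    have "0 \<le> real j * t" using assms by simp
    then have "u - real j * t \<le> 0" using assms by linarith
    then show "0 = E j (u - (\<Sum>ja=1..I. 2 * real (min j ja) * 0) - real j * t)"
      using E_zero[OF j] by simp
  qed (rule assms)
  then show ?thesis by simp
qed

lemma W_strict: "u < u' \<Longrightarrow> W u t < W u' t"
  using Z_growth[of I "W u' t" "W u t" t] Z_W[of t u] Z_W[of t u'] by force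

lemma Y_mono: "u \<le> u' \<Longrightarrow> Y i u t \<le> Y i u' t"
  using Z_growth[of "I - i" "W u t" "W u' t" t] W_strict[of u u' t]
  unfolding Y_def by (cases "u = u'") auto

lemma X_mono: "i \<in> {1..I} \<Longrightarrow> u \<le> u' \<Longrightarrow> X i u t \<le> X i u' t"
  unfolding X_def using Y_mono[of u u' i t] by (intro monoD[OF E_mono]) auto

lemma X_nonneg: "i \<in> {1..I} \<Longrightarrow> 0 \<le> t \<Longrightarrow> 0 \<le> u \<Longrightarrow> 0 \<le> X i u t"
  using X_mono[of i 0 u t] X_zero[of 0 t i] by simp

text \<open>The constants \<open>L\<close> survive for all times, because the shift by
  \<open>i * t\<close> cancels in increments of the argument of \<open>E i\<close>.\<close>

lemma D_bound_X:
  assumes t: "0 \<le> t"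
  shows "D_bound I (\<lambda>i u. X i u t) L"
  unfolding D_bound_def
proof (intro conjI ballI allI impI)
  fix i assume i: "i \<in> {1..I}"
  show "Cc (\<lambda>u. X i u t)"
    unfolding Cc_def
    using continuous_on_subset[OF Ck_continuous_fst[OF Ck_X[OF i]], of "{0..}" t] X_zero[of 0 t i] t i
    by (auto intro!: mono_onI X_mono X_nonneg)
  fix x y :: real assume "x \<le> y"
  have "X i y t - X i x t \<le> L i * ((Y i y t - real i * t) - (Y i x t - real i * t))"
    unfolding X_def by (rule E_Lip[OF i]) (use Y_mono[OF \<open>x \<le> y\<close>] in auto)
  then show "X i y t - X i x t \<le> L i * (phi I (\<lambda>i u. X i u t) i y - phi I (\<lambda>i u. X i u t) i x)"
    using i by (simp add: Y_eq_phi)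
next
  show "strict_mono_on {0..} (phi I (\<lambda>i u. X i u t) I)"
  proof (rule strict_mono_onI)
    fix x y :: real assume "x < y"
    have "Y I u t = W u t" for u unfolding Y_def by (subst Zrec.simps) simp
    then show "phi I (\<lambda>i u. X i u t) I x < phi I (\<lambda>i u. X i u t) I y"
      using W_strict[OF \<open>x < y\<close>, of t] Y_eq_phi[of I _ t] I by simp
  qed
qed (use L_nonneg L_sum in auto)

lemma Ups_eq_profile:
  assumes D: "D_bound I \<psi> L'" and \<psi>: "\<And>u. 0 \<le> u \<Longrightarrow> E i (phi I \<psi> i u) = \<psi> i u"
    and i: "i \<in> {1..I}" and z: "0 \<le> z"
  shows "Ups I \<psi> i z = E i z"
proof -
  note C = D_bound_Cup[OF D i]
  obtain u where u: "0 \<le> u" "phi I \<psi> i u = z" using Cup_surj[OF C z] by blast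
  then show ?thesis using Ups_phi[OF C u(1)] \<psi>[OF u(1)] by simp
qed

text \<open>The family \<open>X\<close> at time \<open>t\<close> lies in D and has the shifted
  profile as its image under \<open>Ups\<close>. Conversely, any element of D with this image solves
  the system at each \<open>u \<ge> 0\<close>, so \<open>X_unique\<close> applies.\<close>

lemma psi_flow_eq_X:
  assumes D: "D_bound I \<psi> L'" and \<psi>: "\<And>i u. i \<in> {1..I} \<Longrightarrow> 0 \<le> u \<Longrightarrow> E i (phi I \<psi> i u) = \<psi> i u"
    and i: "i \<in> {1..I}" and u: "0 \<le> u" and t: "0 \<le> t"
  shows "psi_flow I \<psi> i u t = X i u t"
proof -
  \<comment> \<open>The truncation at 0 in \<open>theta\<close> is absorbed by the profile, which
    vanishes on the negative axis.\<close>
  have th: "theta t (Ups I \<psi>) j z = E j (z - real j * t)" if j: "j \<in> {1..I}" for j z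
    using Ups_eq_profile[OF D \<psi> j, of "max (z - real j * t) 0"] j E_zero[OF j]
    by (auto simp: theta_def max_def split: if_splits)
  show ?thesis
    unfolding psi_flow_def Ups_inv_def
  proof (rule the_equality)
    let ?x = "\<lambda>i u. X i u t"
    note D' = D_bound_X[OF t]
    have "Ups I ?x j z = theta t (Ups I \<psi>) j z" if j: "j \<in> {1..I}" and z: "0 \<le> z" for j z
    proof -
      note C = D_bound_Cup[OF D' j]
      obtain y where y: "0 \<le> y" "phi I ?x j y = z" using Cup_surj[OF C z] by blast
      have "Ups I ?x j z = X j y t" using Ups_phi[OF C y(1)] y by simp
      also have "\<dots> = E j (z - real j * t)" using y Y_eq_phi[OF j, of y t] by (simp add: X_def)
      finally show ?thesis using th[OF j] by simp
    qed
    then show "\<exists>\<psi>'. inD I \<psi>' \<and> (\<forall>j\<in>{1..I}. \<forall>z\<ge>0. Ups I \<psi>' j z = theta t (Ups I \<psi>) j z) \<and> \<psi>' i u = X i u t"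
      using D_bound_imp_inD[OF D' I] by (intro exI[of _ ?x]) auto
  next
    fix v assume "\<exists>\<psi>'. inD I \<psi>' \<and> (\<forall>j\<in>{1..I}. \<forall>z\<ge>0. Ups I \<psi>' j z = theta t (Ups I \<psi>) j z) \<and> \<psi>' i u = v"
    then obtain \<psi>' where p: "inD I \<psi>'" "\<And>j z. j \<in> {1..I} \<Longrightarrow> 0 \<le> z \<Longrightarrow> Ups I \<psi>' j z = theta t (Ups I \<psi>) j z"
      "\<psi>' i u = v" by blast
    note D' = inD_imp_D_bound[OF p(1)]
    have "\<psi>' i u = X i u t"
    proof (rule X_unique[where p="\<lambda>i. \<psi>' i u"])
      fix j assume j: "j \<in> {1..I}"
      note C = D_bound_Cup[OF D' j]
      have "0 \<le> phi I \<psi>' j u" using C u by (auto simp: Cup_def Cc_def)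
      then have "Ups I \<psi>' j (phi I \<psi>' j u) = E j (phi I \<psi>' j u - real j * t)"
        using p(2)[OF j] th[OF j] by simp
      then show "\<psi>' j u = E j (u - (\<Sum>ja=1..I. 2 * real (min j ja) * \<psi>' ja u) - real j * t)"
        using Ups_phi[OF C u] by (simp add: phi_def)
    qed (rule i)
    then show "v = X i u t" using p(3) by simp
  qed
qed

lemma X_initial:
  assumes \<psi>: "\<And>i u. i \<in> {1..I} \<Longrightarrow> 0 \<le> u \<Longrightarrow> E i (phi I \<psi> i u) = \<psi> i u"
    and i: "i \<in> {1..I}" and u: "0 \<le> u"
  shows "X i u 0 = \<psi> i u"
proof -
  have "\<psi> i u = X i u 0"
    by (rule X_unique[where p="\<lambda>i. \<psi> i u"]) (use \<psi> u i in \<open>auto simp: phi_def\<close>)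
  then show ?thesis by simp
qed

definition Xu :: "nat \<Rightarrow> real \<Rightarrow> real \<Rightarrow> real" where
  "Xu i u t = deriv (\<lambda>x. X i x t) u"

definition Xt :: "nat \<Rightarrow> real \<Rightarrow> real \<Rightarrow> real" where
  "Xt i u t = deriv (X i u) t"

lemma
  assumes i: "i \<in> {1..I}"
  shows X_grad: "has_grad (X i) (Xu i u t) (Xt i u t) u t UNIV"
    and Ck_Xu: "Ck k (Xu i)" and Ck_Xt: "Ck k (Xt i)"
proof -
  obtain xu xt where x: "\<And>u t. has_grad (X i) (xu u t) (xt u t) u t UNIV" "Ck k xu" "Ck k xt"
    using Ck_X[OF i] by auto
  have xu: "xu u t = Xu i u t" for u t
    using DERIV_imp_deriv[OF has_grad_du[OF x(1)[of u t], of UNIV]] by (simp add: Xu_def)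
  have xt: "xt u t = Xt i u t" for u t
    using DERIV_imp_deriv[OF has_grad_dt[OF x(1)[of u t], of UNIV]] by (simp add: Xt_def)
  have "xu = Xu i" "xt = Xt i" by (intro ext xu xt)+
  then show "has_grad (X i) (Xu i u t) (Xt i u t) u t UNIV" "Ck k (Xu i)" "Ck k (Xt i)" using x by auto
qed

lemma X_du: "i \<in> {1..I} \<Longrightarrow> ((\<lambda>x. X i x t) has_real_derivative Xu i u t) (at u within S)"
  by (rule has_grad_du[OF X_grad]) auto

lemma X_dt: "i \<in> {1..I} \<Longrightarrow> (X i u has_real_derivative Xt i u t) (at t within S)"
  by (rule has_grad_dt[OF X_grad]) auto

lemma
  assumes i: "i \<in> {1..I}" and u: "0 \<le> u" and t: "0 \<le> t"
  shows Xu_nonneg: "0 \<le> Xu i u t"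
    and dcoef_Xu_pos: "0 < dcoef I (\<lambda>j. Xu j u t) i"
    and Xu_le: "Xu i u t \<le> L i * dcoef I (\<lambda>j. Xu j u t) i"
  using D_bound_deriv_nonneg[OF D_bound_X[OF t] u X_du i] D_bound_dcoef_pos[OF D_bound_X[OF t] u X_du i]
    D_bound_deriv_le[OF D_bound_X[OF t] u X_du i] by simp_all

text \<open>With \<open>e\<close> the slope of \<open>E i\<close>, the chain rule gives
  \<open>Xu = e * d i\<close> and \<open>Xt = - e * (y i + i)\<close>. Hence
  \<open>Xt = - v i * Xu\<close> with \<open>v i = (i + y i) / d i\<close>, and it remains to
  recognise this quotient as the effective speed.\<close>

lemma X_transport:
  assumes i: "i \<in> {1..I}" and u: "0 \<le> u" and t: "0 \<le> t"
  shows "Xt i u t = - veff I (\<lambda>j. Xu j u t) i * Xu i u t"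
proof -
  define d where "d i = dcoef I (\<lambda>j. Xu j u t) i" for i
  define y where "y i = (\<Sum>j=1..I. 2 * real (min i j) * Xt j u t)" for i
  define v where "v i = (real i + y i) / d i" for i
  have d: "0 < d i" if "i \<in> {1..I}" for i unfolding d_def by (rule dcoef_Xu_pos[OF that u t])
  have tv: "Xt i u t = - v i * Xu i u t" if i: "i \<in> {1..I}" for i
  proof -
    obtain e where e: "has_grad (\<lambda>z t. E i z) e 0 (Y i u t - real i * t) 0 UNIV"
    proof -
      obtain eu et where "\<And>u t. has_grad (\<lambda>z t. E i z) (eu u t) (et u t) u t UNIV" using Ck_E[OF i] by auto
      then have "(E i has_real_derivative eu (Y i u t - real i * t) 0) (at (Y i u t - real i * t))"
        using has_grad_du[of "\<lambda>z t. E i z"] by blast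
      then show ?thesis using that has_grad_fst by blast
    qed
    then have e': "(E i has_real_derivative e) (at (Y i u t - real i * t))"
      using has_grad_du[of "\<lambda>z t. E i z"] by blast
    have Yu: "((\<lambda>x. Y i x t - real i * t) has_real_derivative d i) (at u)"
      unfolding d_def using i by (auto simp: Y_eq_phi intro!: derivative_eq_intros phi_deriv X_du)
    have Yt: "((\<lambda>s. Y i u s - real i * s) has_real_derivative - y i - real i) (at t)"
    proof -
      have "((\<lambda>s. (u - (\<Sum>j=1..I. 2 * real (min i j) * X j u s)) - real i * s) has_real_derivative
          (0 - (\<Sum>j=1..I. 2 * real (min i j) * Xt j u t)) - real i * 1) (at t)"
        by (intro DERIV_diff DERIV_const DERIV_sum DERIV_cmult DERIV_ident X_dt)
      then show ?thesis using i by (simp add: Y_eq y_def)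
    qed
    have "Xu i u t = e * d i"
      using DERIV_unique[OF X_du[OF i] DERIV_chain2[OF e' Yu, folded X_def]] .
    moreover have "Xt i u t = e * (- y i - real i)"
      using DERIV_unique[OF X_dt[OF i] DERIV_chain2[OF e' Yt, folded X_def]] .
    moreover have "v i * d i = real i + y i" using d[OF i] by (simp add: v_def)
    ultimately show ?thesis by (simp add: algebra_simps)
  qed
  have "veff I (\<lambda>j. Xu j u t) i = v i"
  proof (rule veff_unique[OF I _ _ _ i])
    fix i assume i: "i \<in> {1..I}"
    \<comment> \<open>Inserting the transport relation into the sum \<open>y i\<close> eliminates
      the time derivatives and closes the linear system for \<open>v\<close>.\<close>
    have "(\<Sum>j=1..I. 2 * real (min i j) * Xu j u t * v j) = (\<Sum>j=1..I. - (2 * real (min i j) * Xt j u t))"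
      using tv by (intro sum.cong) auto
    also have "\<dots> = - y i" by (simp add: y_def sum_negf)
    finally show "v i * dcoef I (\<lambda>j. Xu j u t) i + (\<Sum>j=1..I. 2 * real (min i j) * Xu j u t * v j) = real i"
      using d[OF i] by (simp add: v_def d_def)
  qed (use Xu_nonneg dcoef_Xu_pos u t in auto)
  then show ?thesis using tv[OF i] by simp
qed

end

section \<open>Solutions on the quadrant\<close>

lemma at_within_atLeast_ne_bot: "(0::real) \<le> u \<Longrightarrow> at u within {0..} \<noteq> bot"
proof -
  assume "0 \<le> u"
  have "at u within {u..} \<le> at u within {0..}" using \<open>0 \<le> u\<close> by (intro at_le) auto
  moreover have "at u within {u..} \<noteq> bot" by (simp add: at_within_Ici_at_right)
  ultimately show ?thesis by (metis bot.extremum_uniqueI)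
qed

lemma du_eq: "0 \<le> u \<Longrightarrow> ((\<lambda>x. g x t) has_real_derivative d) (at u within {0..}) \<Longrightarrow> du g u t = d"
  unfolding du_def has_real_derivative_iff_has_vector_derivative
  by (intro vector_derivative_within at_within_atLeast_ne_bot)

lemma dt_eq: "0 \<le> t \<Longrightarrow> (g u has_real_derivative d) (at t within {0..}) \<Longrightarrow> dt g u t = d"
  unfolding dt_def has_real_derivative_iff_has_vector_derivative
  by (intro vector_derivative_within at_within_atLeast_ne_bot)

text \<open>The derivative is taken within the half-line, so agreement there suffices;
  \<open>psi_flow\<close> is identified only on the quadrant.\<close>

lemma du_cong:
  assumes "\<And>x. 0 \<le> x \<Longrightarrow> g x t = g' x t" "0 \<le> u"
  shows "du g u t = du g' u t"
proof -
  have "((\<lambda>x. g x t) has_vector_derivative d) (at u within {0..}) =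
      ((\<lambda>x. g' x t) has_vector_derivative d) (at u within {0..})" for d
    by (rule has_vector_derivative_cong_ev) (use assms in auto)
  then show ?thesis unfolding du_def vector_derivative_def by simp
qed

lemma dt_cong:
  assumes "\<And>s. 0 \<le> s \<Longrightarrow> g u s = g' u s" "0 \<le> t"
  shows "dt g u t = dt g' u t"
proof -
  have "((\<lambda>s. g u s) has_vector_derivative d) (at t within {0..}) =
      ((\<lambda>s. g' u s) has_vector_derivative d) (at t within {0..})" for d
    by (rule has_vector_derivative_cong_ev) (use assms in auto)
  then show ?thesis unfolding dt_def vector_derivative_def by simp
qed

lemma has_grad_du_Q: "has_grad g a b u t Q \<Longrightarrow> 0 \<le> u \<Longrightarrow> 0 \<le> t \<Longrightarrow> du g u t = a"
  by (rule du_eq) (auto intro: has_grad_du simp: Q_def)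

lemma has_grad_dt_Q: "has_grad g a b u t Q \<Longrightarrow> 0 \<le> u \<Longrightarrow> 0 \<le> t \<Longrightarrow> dt g u t = b"
  by (rule dt_eq) (auto intro: has_grad_dt simp: Q_def)

lemma has_grad_cong_Q:
  assumes "has_grad g a b u t UNIV" "\<And>u t. 0 \<le> u \<Longrightarrow> 0 \<le> t \<Longrightarrow> g' u t = g u t" "0 \<le> u" "0 \<le> t"
  shows "has_grad g' a b u t Q"
proof -
  have "has_grad g a b u t Q" using has_derivative_subset[OF assms(1)] by simp
  then show ?thesis
    by (rule has_derivative_transform[rotated 2]) (use assms in \<open>auto simp: Q_def\<close>)
qed

lemma C1q_I:
  assumes "Ck 1 g" "\<And>u t. 0 \<le> u \<Longrightarrow> 0 \<le> t \<Longrightarrow> g' u t = g u t"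
  shows "C1q g'"
proof -
  obtain gu gt where g: "\<And>u t. has_grad g (gu u t) (gt u t) u t UNIV" "Ck 0 gu" "Ck 0 gt"
    using assms(1) by (auto simp: One_nat_def)
  have "has_grad g' (gu u t) (gt u t) u t Q" if "0 \<le> u" "0 \<le> t" for u t
    by (rule has_grad_cong_Q[OF g(1) assms(2)]) (use that in auto)
  moreover have "continuous_on Q (\<lambda>p. gu (fst p) (snd p))" "continuous_on Q (\<lambda>p. gt (fst p) (snd p))"
    using g(2,3) by (auto intro: continuous_on_subset)
  ultimately show ?thesis unfolding C1q_def by blast
qed

lemma C2q_I:
  assumes "\<And>u t. has_grad g (gu u t) (gt u t) u t UNIV" "Ck 1 gu" "Ck 1 gt"
    and "\<And>u t. 0 \<le> u \<Longrightarrow> 0 \<le> t \<Longrightarrow> g' u t = g u t"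
  shows "C2q g'"
proof -
  have "has_grad g' (gu u t) (gt u t) u t Q" if "0 \<le> u" "0 \<le> t" for u t
    by (rule has_grad_cong_Q[OF assms(1) assms(4)]) (use that in auto)
  moreover have "C1q gu" "C1q gt" using assms C1q_I by blast+
  ultimately show ?thesis unfolding C2q_def by blast
qed

lemma C1qE:
  assumes "C1q g"
  obtains "\<And>u t. 0 \<le> u \<Longrightarrow> 0 \<le> t \<Longrightarrow> has_grad g (du g u t) (dt g u t) u t Q"
    "continuous_on Q (\<lambda>p. du g (fst p) (snd p))" "continuous_on Q (\<lambda>p. dt g (fst p) (snd p))"
proof -
  obtain gu gt where g: "\<And>u t. 0 \<le> u \<Longrightarrow> 0 \<le> t \<Longrightarrow> has_grad g (gu u t) (gt u t) u t Q"
    "continuous_on Q (\<lambda>p. gu (fst p) (snd p))" "continuous_on Q (\<lambda>p. gt (fst p) (snd p))"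
    using assms unfolding C1q_def by blast
  have eq: "du g u t = gu u t" "dt g u t = gt u t" if "0 \<le> u" "0 \<le> t" for u t
    using has_grad_du_Q[OF g(1)] has_grad_dt_Q[OF g(1)] that by auto
  show thesis
  proof (rule that)
    show "has_grad g (du g u t) (dt g u t) u t Q" if "0 \<le> u" "0 \<le> t" for u t
      using g(1)[OF that] eq[OF that] by simp
    show "continuous_on Q (\<lambda>p. du g (fst p) (snd p))"
      using g(2) by (rule continuous_on_cong[THEN iffD1, rotated -1]) (auto simp: Q_def eq)
    show "continuous_on Q (\<lambda>p. dt g (fst p) (snd p))"
      using g(3) by (rule continuous_on_cong[THEN iffD1, rotated -1]) (auto simp: Q_def eq)
  qed
qed

lemma D_bound_cong:
  assumes D: "D_bound I \<psi> L" and eq: "\<And>i u. i \<in> {1..I} \<Longrightarrow> 0 \<le> u \<Longrightarrow> \<psi>' i u = \<psi> i u"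
  shows "D_bound I \<psi>' L"
proof -
  have phi: "phi I \<psi>' i u = phi I \<psi> i u" if "0 \<le> u" for i u
    using eq that unfolding phi_def by (auto intro!: sum.cong)
  have "Cc (\<psi>' i)" if "i \<in> {1..I}" for i
  proof -
    have "continuous_on {0..} (\<psi>' i) = continuous_on {0..} (\<psi> i)"
      by (rule continuous_on_cong) (use eq that in auto)
    then show ?thesis using D_bound_Cc[OF D that] eq[OF that] unfolding Cc_def mono_on_def by auto
  qed
  then show ?thesis
    using D eq phi unfolding D_bound_def strict_mono_on_def by auto
qed

lemma C1plus_I:
  assumes "Ck 1 g" "\<And>u. u \<le> 0 \<Longrightarrow> g u t = 0" "\<And>u. 0 \<le> u \<Longrightarrow> f u = g u t \<and> 0 \<le> f u"
  shows "C1plus f"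
proof -
  have "Ck 1 (\<lambda>x s. g x t)" by (rule Ck_compose[OF assms(1) Ck_fst Ck_const])
  moreover have "ext0 f = (\<lambda>x. g x t)" using assms by (intro ext) auto
  ultimately show ?thesis using assms(3) unfolding C1plus_iff by metis
qed

section \<open>Existence and uniqueness for the transport equation\<close>

lemma (in profile) sol_a_X:
  assumes D: "D_bound I \<psi> L'" and \<psi>: "\<And>i u. i \<in> {1..I} \<Longrightarrow> 0 \<le> u \<Longrightarrow> E i (phi I \<psi> i u) = \<psi> i u"
  shows "sol_a I \<psi> (psi_flow I \<psi>)"
proof -
  have eq: "psi_flow I \<psi> i u t = X i u t" if "i \<in> {1..I}" "0 \<le> u" "0 \<le> t" for i u t
    by (rule psi_flow_eq_X[OF D \<psi> that])
  have Ck1: "Ck 1 (X i)" if "i \<in> {1..I}" for i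
    using X_grad[OF that] Ck_Xu[OF that] Ck_Xt[OF that] Ck_continuous[of k]
    unfolding One_nat_def Ck.simps by blast
  have du: "du (psi_flow I \<psi> i) u t = Xu i u t" if "i \<in> {1..I}" "0 \<le> u" "0 \<le> t" for i u t
    by (rule has_grad_du_Q[OF has_grad_cong_Q[where g="X i", OF X_grad eq]]) (use that in auto)
  have dt: "dt (psi_flow I \<psi> i) u t = Xt i u t" if "i \<in> {1..I}" "0 \<le> u" "0 \<le> t" for i u t
    by (rule has_grad_dt_Q[OF has_grad_cong_Q[where g="X i", OF X_grad eq]]) (use that in auto)
  have "inD1 I (\<lambda>i u. psi_flow I \<psi> i u t)" if t: "0 \<le> t" for t
  proof -
    have "inD I (\<lambda>i u. psi_flow I \<psi> i u t)"
      by (rule D_bound_imp_inD[OF D_bound_cong[OF D_bound_X[OF t]] I]) (use eq t in auto)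
    moreover have "C1plus (\<lambda>u. psi_flow I \<psi> i u t)" if i: "i \<in> {1..I}" for i
      by (rule C1plus_I[OF Ck1[OF i], of t]) (use eq X_zero X_nonneg t i in auto)
    ultimately show ?thesis unfolding inD1_def by blast
  qed
  moreover have "C1q (psi_flow I \<psi> i)" if i: "i \<in> {1..I}" for i
    by (rule C1q_I[OF Ck1[OF i]]) (use eq i in auto)
  moreover have "dt (psi_flow I \<psi> i) u t = - veff I (\<lambda>j. du (psi_flow I \<psi> j) u t) i * du (psi_flow I \<psi> i) u t"
    if "i \<in> {1..I}" "0 \<le> u" "0 \<le> t" for i u t
    using X_transport[OF that] veff_cong[of I "\<lambda>j. du (psi_flow I \<psi> j) u t" "\<lambda>j. Xu j u t"] du dt that by simp
  ultimately show ?thesis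
    unfolding sol_a_def nonnegq_def using eq X_nonneg X_initial[OF \<psi>] by auto
qed

text \<open>For each \<open>i\<close> the level curves of \<open>\<Phi> i u s - i * s\<close> move
  with speed \<open>veff\<close> of index \<open>i\<close>, so they are the characteristics of the
  equation and \<open>\<xi> i\<close> is constant on them. Following a curve back to the boundary of
  the quadrant yields the system that determines \<open>X\<close>.\<close>

lemma (in profile) sol_a_unique:
  assumes \<psi>: "\<And>i u. i \<in> {1..I} \<Longrightarrow> 0 \<le> u \<Longrightarrow> E i (phi I \<psi> i u) = \<psi> i u"
    and sol: "sol_a I \<psi> \<xi>" and i: "i \<in> {1..I}" and u: "0 \<le> u" and t: "0 \<le> t"
  shows "\<xi> i u t = X i u t"
proof -
  have g: "has_grad (\<xi> i) (du (\<xi> i) u t) (dt (\<xi> i) u t) u t Q" if "i \<in> {1..I}" "0 \<le> u" "0 \<le> t" for i u t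
    using sol that unfolding sol_a_def by (blast elim: C1qE)
  have D: "D_bound I (\<lambda>i u. \<xi> i u t) (\<lambda>i. Sup (ratio_set I (\<lambda>i u. \<xi> i u t) i))" if "0 \<le> t" for t
    using sol that inD_imp_D_bound unfolding sol_a_def inD1_def by blast
  have pde: "dt (\<xi> i) u t = - veff I (\<lambda>j. du (\<xi> j) u t) i * du (\<xi> i) u t"
    if "i \<in> {1..I}" "0 \<le> u" "0 \<le> t" for i u t using sol that unfolding sol_a_def by blast
  have init: "\<xi> i u 0 = \<psi> i u" if "i \<in> {1..I}" "0 \<le> u" for i u using sol that unfolding sol_a_def by blast
  define \<Phi> where "\<Phi> i u t = phi I (\<lambda>i u. \<xi> i u t) i u" for i u t
  have Cup: "Cup (\<lambda>u. \<Phi> i u t)" if "i \<in> {1..I}" "0 \<le> t" for i t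
    using D_bound_Cup[OF D[OF that(2)] that(1)] unfolding \<Phi>_def .
  have d: "((\<lambda>x. \<xi> j x t) has_real_derivative du (\<xi> j) u t) (at u within {0..})"
    if "j \<in> {1..I}" "0 \<le> u" "0 \<le> t" for j u t
    by (rule has_grad_du[OF g[OF that]]) (use that in \<open>auto simp: Q_def\<close>)
  have char: "\<xi> i u t = E i (\<Phi> i u t - real i * t)" if i: "i \<in> {1..I}" and u: "0 \<le> u" and t: "0 \<le> t" for i u t
  proof -
    define z where "z = \<Phi> i u t - real i * t"
    \<comment> \<open>These are the times \<open>s \<ge> 0\<close> with
      \<open>z + i * s \<ge> 0\<close>, where the level curve stays in the quadrant. At the left
      endpoint it meets the axis of time 0 or the axis \<open>u = 0\<close>.\<close>
    define T where "T = {max 0 (- z / real i)..}"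
    have i0: "0 < real i" using i by simp
    have T: "0 \<le> s" "0 \<le> z + real i * s" if "s \<in> T" for s
      using that i0 by (auto simp: T_def field_simps)
    have "0 \<le> \<Phi> i u t" using Cup[OF i t] u by (auto simp: Cup_def Cc_def)
    then have tT: "t \<in> T" using t i0 by (auto simp: T_def z_def field_simps)
    have "\<exists>x. \<forall>s\<in>T. 0 \<le> x s \<and> \<Phi> i (x s) s = z + real i * s"
      using Cup_surj[OF Cup[OF i]] T by (intro bchoice) blast
    then obtain x where x: "\<And>s. s \<in> T \<Longrightarrow> 0 \<le> x s" "\<And>s. s \<in> T \<Longrightarrow> \<Phi> i (x s) s = z + real i * s" by blast
    have inj: "a = b" if "0 \<le> a" "0 \<le> b" "\<Phi> i a s = \<Phi> i b s" "0 \<le> s" for a b s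
      using inj_onD[OF Cup_inj_on[OF Cup[OF i \<open>0 \<le> s\<close>]]] that by auto
    have xt: "x t = u" using inj[OF x(1)[OF tT] u _ t] x(2)[OF tT] by (simp add: z_def)
    have "((\<lambda>s. \<xi> i (x s) s) has_real_derivative 0) (at s within T)" if s: "s \<in> T" for s
    proof -
      note s0 = T(1)[OF s]
      define r where "r j = du (\<xi> j) (x s) s" for j
      define q where "q j = dt (\<xi> j) (x s) s" for j
      define y where "y = (\<Sum>j=1..I. 2 * real (min i j) * q j)"
      note dr = d[OF _ x(1)[OF s] s0, folded r_def]
      have dpos: "0 < dcoef I r j" if "j \<in> {1..I}" for j
        by (rule D_bound_dcoef_pos[OF D[OF s0] x(1)[OF s] dr that])
      have rnonneg: "0 \<le> r j" if "j \<in> {1..I}" for j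
        by (rule D_bound_deriv_nonneg[OF D[OF s0] x(1)[OF s] dr that])
      have qr: "q j = - veff I r j * r j" if "j \<in> {1..I}" for j
        using pde[OF that x(1)[OF s] s0] unfolding q_def r_def .
      have "(\<Sum>j=1..I. 2 * real (min i j) * r j * veff I r j) = (\<Sum>j=1..I. - (2 * real (min i j) * q j))"
        using qr by (intro sum.cong) auto
      \<comment> \<open>Row \<open>i\<close> of the system for the speeds, with the products of
        densities and speeds replaced by time derivatives through the equation.\<close>
      then have speed: "veff I r i * dcoef I r i - y = real i"
        using veff_system[OF I rnonneg dpos i] by (simp add: y_def sum_negf)
      have F: "has_grad (\<lambda>u s. \<Phi> i u s - real i * s) (dcoef I r i) (- y - real i) (x s) s Q"
      proof -
        have "((\<lambda>p. (fst p - (\<Sum>j=1..I. 2 * real (min i j) * \<xi> j (fst p) (snd p))) - real i * snd p) has_derivative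
            (\<lambda>h. (fst h - (\<Sum>j=1..I. 2 * real (min i j) * (r j * fst h + q j * snd h))) - real i * snd h))
            (at (x s, s) within Q)"
          unfolding r_def q_def
          by (intro has_derivative_diff has_derivative_sum has_derivative_mult_right g x s0 s
              has_derivative_fst has_derivative_snd has_derivative_ident)
        then show ?thesis
          unfolding \<Phi>_def phi_def
          by (rule has_derivative_eq_rhs)
            (auto simp: dcoef_def y_def sum.distrib sum_distrib_left sum_distrib_right algebra_simps)
      qed
      \<comment> \<open>The curve was chosen point by point; strict monotonicity of
        \<open>\<Phi>\<close> in \<open>u\<close> forces it to be continuous.\<close>
      have cont: "continuous (at s within T) x"
      proof (rule continuous_within_implicit[where A="{0..}" and G="\<lambda>u s. \<Phi> i u s - real i * s" and c=z])
        show "strict_mono_on {0..} (\<lambda>u. \<Phi> i u s - real i * s)" if "s \<in> T" for s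
          using Cup[OF i T(1)[OF that]] by (auto simp: Cup_def strict_mono_on_def)
        show "continuous_on T (\<lambda>s. \<Phi> i u s - real i * s)" if u: "u \<in> {0..}" for u
        proof -
          have "continuous_on T (\<xi> j u)" if j: "j \<in> {1..I}" for j
          proof -
            have "(\<xi> j u has_real_derivative dt (\<xi> j) u s) (at s within T)" if "s \<in> T" for s
              by (rule has_grad_dt[OF g[OF j]]) (use u T that in \<open>auto simp: Q_def\<close>)
            then show ?thesis by (rule DERIV_continuous_on)
          qed
          then show ?thesis unfolding \<Phi>_def phi_def by (intro continuous_intros)
        qed
      qed (use x s in auto)
      \<comment> \<open>Implicit differentiation gives the slope
        \<open>(y + i) / dcoef I r i\<close>, which \<open>speed\<close> identifies as the effective
        speed.\<close>
      have "(x has_derivative (\<lambda>h. - ((- y - real i) * h) / dcoef I r i)) (at s within T)"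
        by (rule implicit_has_derivative[where F="\<lambda>p. \<Phi> i (fst p) (snd p) - real i * snd p" and X=Q and c=z])
          (use F cont x s T(1) dpos[OF i] in \<open>auto simp: Q_def\<close>)
      moreover have "(\<lambda>h. - ((- y - real i) * h) / dcoef I r i) = (*) (veff I r i)"
        using speed dpos[OF i] by (intro ext) (auto simp: field_simps)
      ultimately have "(x has_real_derivative veff I r i) (at s within T)"
        by (simp add: has_field_derivative_def)
      then have "((\<lambda>s. \<xi> i (x s) s) has_real_derivative r i * veff I r i + q i) (at s within T)"
        unfolding r_def q_def
        by (intro has_grad_curve[where x=x and g="\<xi> i" and S=Q, OF g[OF i x(1)[OF s] s0]])
          (use x T in \<open>auto simp: Q_def\<close>)
      then show ?thesis using qr[OF i] by simp
    qed
    moreover have "convex T" by (simp add: T_def)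
    ultimately obtain c where c: "\<And>s. s \<in> T \<Longrightarrow> \<xi> i (x s) s = c"
      using has_field_derivative_zero_constant[of T "\<lambda>s. \<xi> i (x s) s"] by blast
    define s where "s = max 0 (- z / real i)"
    have s: "s \<in> T" by (simp add: s_def T_def)
    have "\<xi> i u t = \<xi> i (x s) s" using c[OF tT] c[OF s] xt by simp
    also have "\<dots> = E i z"
    \<comment> \<open>If \<open>z \<ge> 0\<close>, the curve starts at time 0 and the initial
      profile gives the value. Otherwise it enters through \<open>u = 0\<close>, where
      \<open>\<xi> i\<close> vanishes, in agreement with \<open>E i z = 0\<close>.\<close>
    proof (cases "0 \<le> z")
      case True
      then have s0: "s = 0" using i0 by (simp add: s_def)
      have "\<Phi> i (x 0) 0 = phi I \<psi> i (x 0)"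
        using init x(1)[OF s] s0 unfolding \<Phi>_def phi_def by (auto intro!: sum.cong)
      then show ?thesis using \<psi>[OF i x(1)[OF s]] init[OF i x(1)[OF s]] x(2)[OF s] s0 by simp
    next
      case False
      then have s0: "real i * s = - z" using i0 by (simp add: s_def max_def field_simps)
      have z0: "\<xi> i 0 s = 0" "\<Phi> i 0 s = 0"
        using D_bound_Cc[OF D[OF T(1)[OF s]] i] Cup[OF i T(1)[OF s]] by (auto simp: Cc_def Cup_def)
      have "x s = 0" by (rule inj[OF x(1)[OF s] _ _ T(1)[OF s]]) (use x(2)[OF s] s0 z0 in auto)
      then show ?thesis using z0 E_zero[OF i] False by simp
    qed
    finally show ?thesis by (simp add: z_def)
  qed
  show ?thesis
    by (rule X_unique[where p="\<lambda>i. \<xi> i u t"]) (use char u t i in \<open>auto simp: \<Phi>_def phi_def\<close>)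
qed

section \<open>Densities\<close>

lemma ext0_continuous_zero:
  assumes "continuous_on UNIV (ext0 r)"
  shows "r 0 = 0"
proof -
  have "(ext0 r \<longlongrightarrow> ext0 r 0) (at 0)" using assms unfolding continuous_on_def by blast
  then have "(ext0 r \<longlongrightarrow> ext0 r 0) (at_left 0)" by (rule tendsto_within_subset) simp
  moreover have "\<forall>\<^sub>F x in at_left (0::real). ext0 r x = 0"
    by (simp add: eventually_at_filter)
  then have "(ext0 r \<longlongrightarrow> 0) (at_left 0)" by (rule tendsto_eventually)
  ultimately have "ext0 r 0 = 0" by (intro tendsto_unique[of "at_left (0::real)"]) auto
  then show ?thesis by simp
qed

text \<open>There is no corner at 0, since continuity of the extension forces
  \<open>r 0 = 0\<close>. Starting the integral at a negative \<open>a\<close> adds nothing to it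
  and makes every point, including 0, interior.\<close>

lemma ext0_integral_deriv:
  assumes r: "continuous_on UNIV (ext0 r)"
  shows "(ext0 (\<lambda>u. integral {0..u} r) has_real_derivative ext0 r x) (at x)"
proof -
  define a b where "a = - \<bar>x\<bar> - 1" and "b = \<bar>x\<bar> + 1"
  have ab: "a < x" "x < b" "a < 0" by (auto simp: a_def b_def)
  have c: "continuous_on S (ext0 r)" for S using r by (rule continuous_on_subset) simp
  have zero: "integral {a..y} (ext0 r) = 0" if "y \<le> 0" for y
  proof -
    have "integral {a..y} (ext0 r) = integral {a..y} (\<lambda>_. 0)"
    proof (rule integral_cong)
      fix x assume "x \<in> {a..y}"
      then show "ext0 r x = 0" using that ext0_continuous_zero[OF r] by (cases "x = 0") auto
    qed
    then show ?thesis by simp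
  qed
  have eq: "integral {a..y} (ext0 r) = ext0 (\<lambda>u. integral {0..u} r) y" if "a < y" for y
  proof (cases "y < 0")
    case False
    have "integral {a..0} (ext0 r) + integral {0..y} (ext0 r) = integral {a..y} (ext0 r)"
      using False ab by (intro Henstock_Kurzweil_Integration.integral_combine integrable_continuous_real c) auto
    moreover have "integral {0..y} (ext0 r) = integral {0..y} r" by (intro integral_cong) auto
    ultimately show ?thesis using zero[of 0] False by simp
  qed (use zero in auto)
  have "((\<lambda>y. integral {a..y} (ext0 r)) has_real_derivative ext0 r x) (at x)"
    using integral_has_real_derivative[OF c, of x a b] ab by (simp add: at_within_Icc_at)
  then show ?thesis
    by (rule has_field_derivative_transform_within_open[of _ _ _ "{a<..}"]) (use eq ab in auto)
qed

lemma integral_deriv_within: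
  assumes r: "continuous_on UNIV (ext0 r)" and x: "0 \<le> x"
  shows "((\<lambda>u. integral {0..u} r) has_real_derivative r x) (at x within {0..})"
proof -
  have "(ext0 (\<lambda>u. integral {0..u} r) has_real_derivative r x) (at x within {0..})"
    using has_field_derivative_at_within[OF ext0_integral_deriv[OF r, of x]] x by simp
  then show ?thesis
    by (rule has_field_derivative_transform_within[OF _ zero_less_one]) (use x in auto)
qed

lemma dcoef_pos:
  assumes r: "\<And>j. j \<in> {1..I} \<Longrightarrow> 0 \<le> r j" and s: "(\<Sum>j=1..I. 2 * real j * r j) < 1"
  shows "0 < dcoef I r i"
proof -
  have "(\<Sum>j=1..I. 2 * real (min i j) * r j) \<le> (\<Sum>j=1..I. 2 * real j * r j)"
    using r by (intro sum_mono mult_right_mono) auto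
  then show ?thesis using s by (simp add: dcoef_def)
qed

lemma dens_set_dcoef: "dens_set I \<rho> i = (\<lambda>u. \<rho> i u / dcoef I (\<lambda>j. \<rho> j u) i) ` {0..}"
  by (simp add: dens_set_def dcoef_def)

context
  fixes I \<rho> assumes D: "inDdens I \<rho>"
begin

lemma inDdens_Ck: "i \<in> {1..I} \<Longrightarrow> Ck 1 (\<lambda>x t. ext0 (\<rho> i) x)"
  and inDdens_nonneg: "i \<in> {1..I} \<Longrightarrow> 0 \<le> u \<Longrightarrow> 0 \<le> \<rho> i u"
  using D unfolding inDdens_def C1plus_iff by blast+

lemma inDdens_continuous: "i \<in> {1..I} \<Longrightarrow> continuous_on UNIV (ext0 (\<rho> i))"
  using Ck_continuous_fst[OF inDdens_Ck] .

lemma inDdens_Ck_integral: "i \<in> {1..I} \<Longrightarrow> Ck (Suc 1) (\<lambda>x t. ext0 (\<lambda>u. integral {0..u} (\<rho> i)) x)"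
  by (rule Ck_Suc_fst[OF ext0_integral_deriv[OF inDdens_continuous] inDdens_Ck])

lemma inDdens_dcoef_pos: "0 \<le> u \<Longrightarrow> 0 < dcoef I (\<lambda>j. \<rho> j u) i"
  using D inDdens_nonneg by (intro dcoef_pos) (auto simp: inDdens_def)

lemma inDdens_le:
  assumes "i \<in> {1..I}" "0 \<le> u"
  shows "\<rho> i u \<le> Sup (dens_set I \<rho> i) * dcoef I (\<lambda>j. \<rho> j u) i"
proof -
  have "\<rho> i u / dcoef I (\<lambda>j. \<rho> j u) i \<le> Sup (dens_set I \<rho> i)"
    using D assms by (intro cSup_upper) (auto simp: dens_set_dcoef inDdens_def)
  then show ?thesis using inDdens_dcoef_pos[OF assms(2)] by (simp add: pos_divide_le_eq)
qed

text \<open>The pointwise bound of the density by its supremum times \<open>dcoef\<close> says that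
  \<open>Sup (dens_set I \<rho> i) * phi - p\<close> has nonnegative slope. Integration turns it
  into the bound on increments.\<close>

lemma inDdens_D_bound:
  "D_bound I (\<lambda>i u. integral {0..u} (\<rho> i)) (\<lambda>i. Sup (dens_set I \<rho> i))"
proof -
  define p where "p i = ext0 (\<lambda>u. integral {0..u} (\<rho> i))" for i
  have dp: "(p i has_real_derivative ext0 (\<rho> i) u) (at u)" if "i \<in> {1..I}" for i u
    unfolding p_def by (rule ext0_integral_deriv[OF inDdens_continuous[OF that]])
  have dphi: "(phi I p i has_real_derivative dcoef I (\<lambda>j. \<rho> j u) i) (at u)" if "0 \<le> u" for i u
    using phi_deriv[OF dp, where I=I and u=u and i=i] that by simp
  have pmono: "p i x \<le> p i y" if "i \<in> {1..I}" "0 \<le> x" "x \<le> y" for i x y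
  proof (rule DERIV_nonneg_imp_nondecreasing[OF that(3)])
    fix u assume "x \<le> u"
    then show "\<exists>d. (p i has_real_derivative d) (at u) \<and> 0 \<le> d"
      using dp[OF that(1), of u] inDdens_nonneg[OF that(1), of u] that(2) by (intro exI[of _ "ext0 (\<rho> i) u"]) auto
  qed
  have p0: "p i 0 = 0" for i by (simp add: p_def)
  have "Cc (p i)" if i: "i \<in> {1..I}" for i
    unfolding Cc_def using pmono[OF i] pmono[OF i, of 0] p0 DERIV_isCont[OF dp[OF i]]
    by (auto intro!: mono_onI continuous_at_imp_continuous_on)
  moreover have "strict_mono_on {0..} (phi I p I)"
  proof (rule strict_mono_onI)
    fix x y :: real assume x: "x \<in> {0..}" "x < y"
    show "phi I p I x < phi I p I y"
    proof (rule DERIV_pos_imp_increasing[OF x(2)])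
      fix u assume "x \<le> u"
      then show "\<exists>d. (phi I p I has_real_derivative d) (at u) \<and> 0 < d"
        using dphi[of u I] inDdens_dcoef_pos[of u I] x(1) by (intro exI[of _ "dcoef I (\<lambda>j. \<rho> j u) I"]) auto
    qed
  qed
  moreover have "0 \<le> Sup (dens_set I \<rho> i)" if i: "i \<in> {1..I}" for i
  proof -
    have "\<rho> i 0 \<le> Sup (dens_set I \<rho> i) * dcoef I (\<lambda>j. \<rho> j 0) i" by (rule inDdens_le[OF i]) simp
    then have "0 \<le> Sup (dens_set I \<rho> i) * dcoef I (\<lambda>j. \<rho> j 0) i" using inDdens_nonneg[OF i, of 0] by simp
    then show ?thesis using inDdens_dcoef_pos[of 0 i] by (simp add: zero_le_mult_iff)
  qed
  moreover have "p i y - p i x \<le> Sup (dens_set I \<rho> i) * (phi I p i y - phi I p i x)"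
    if i: "i \<in> {1..I}" and x: "0 \<le> x" "x \<le> y" for i x y
  proof -
    let ?S = "Sup (dens_set I \<rho> i)"
    have "?S * phi I p i x - p i x \<le> ?S * phi I p i y - p i y"
    proof (rule DERIV_nonneg_imp_nondecreasing[OF x(2)])
      fix u assume "x \<le> u"
      then have u: "0 \<le> u" using x by simp
      have "((\<lambda>x. ?S * phi I p i x - p i x) has_real_derivative ?S * dcoef I (\<lambda>j. \<rho> j u) i - ext0 (\<rho> i) u) (at u)"
        by (intro DERIV_diff DERIV_cmult dphi dp u i)
      moreover have "0 \<le> ?S * dcoef I (\<lambda>j. \<rho> j u) i - ext0 (\<rho> i) u" using inDdens_le[OF i u] u by simp
      ultimately show "\<exists>y. ((\<lambda>x. ?S * phi I p i x - p i x) has_real_derivative y) (at u) \<and> 0 \<le> y" by blast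
    qed
    then show ?thesis by (simp add: algebra_simps)
  qed
  ultimately have "D_bound I p (\<lambda>i. Sup (dens_set I \<rho> i))"
    unfolding D_bound_def using D by (auto simp: inDdens_def)
  then show ?thesis by (rule D_bound_cong) (simp add: p_def)
qed

end

text \<open>Symmetry of mixed derivatives by integration: \<open>g x s - g a s\<close> is the
  integral of \<open>gu\<close>, and differentiating under the integral in \<open>s\<close>
  expresses \<open>gt x t - gt a t\<close> as the integral of \<open>gut\<close>.\<close>

lemma mixed_partial:
  assumes g: "\<And>u t. has_grad g (gu u t) (gt u t) u t UNIV"
    and gu: "continuous_on UNIV (\<lambda>p. gu (fst p) (snd p))"
    and gut: "\<And>u t. (gu u has_real_derivative gut u t) (at t)"
    and cont: "continuous_on UNIV (\<lambda>p. gut (fst p) (snd p))"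
  shows "((\<lambda>x. gt x t) has_real_derivative gut u t) (at u)"
proof -
  define a b where "a = u - 1" and "b = u + 1"
  have c1: "continuous_on S (\<lambda>y. gu y s)" for S s
  proof -
    have "continuous_on S (\<lambda>y. gu (fst (y, s)) (snd (y, s)))"
      by (rule continuous_on_compose2[OF gu]) (auto intro!: continuous_intros)
    then show ?thesis by simp
  qed
  have c2: "continuous_on S (\<lambda>y. gut y s)" for S s
  proof -
    have "continuous_on S (\<lambda>y. gut (fst (y, s)) (snd (y, s)))"
      by (rule continuous_on_compose2[OF cont]) (auto intro!: continuous_intros)
    then show ?thesis by simp
  qed
  have c3: "continuous_on S (\<lambda>(s, y). gut y s)" for S
  proof -
    have "continuous_on S (\<lambda>q. gut (fst (snd q, fst q)) (snd (snd q, fst q)))"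
      by (rule continuous_on_compose2[OF cont]) (auto intro!: continuous_intros)
    then show ?thesis by (simp add: case_prod_unfold)
  qed
  have eq: "gt x t = gt a t + integral {a..x} (\<lambda>y. gut y t)" if x: "a \<le> x" for x
  proof -
    have "integral (cbox a x) (\<lambda>y. gu y s) = g x s - g a s" for s
    proof -
      have "((\<lambda>y. gu y s) has_integral (g x s - g a s)) {a..x}"
        using has_grad_du[OF g] x
        by (intro fundamental_theorem_of_calculus) (auto simp: has_real_derivative_iff_has_vector_derivative[symmetric])
      then show ?thesis by (simp add: integral_unique)
    qed
    moreover have "((\<lambda>s. integral (cbox a x) (\<lambda>y. gu y s)) has_real_derivative integral (cbox a x) (\<lambda>y. gut y t)) (at t)"
      using c1 c3 gut
      by (intro leibniz_rule_field_derivative[where U=UNIV]) (auto intro!: integrable_continuous_real)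
    ultimately have "((\<lambda>s. g x s - g a s) has_real_derivative integral {a..x} (\<lambda>y. gut y t)) (at t)" by simp
    moreover have "((\<lambda>s. g x s - g a s) has_real_derivative gt x t - gt a t) (at t)"
      by (intro DERIV_diff has_grad_dt[OF g]) auto
    ultimately show ?thesis using DERIV_unique by fastforce
  qed
  have "((\<lambda>x. gt a t + integral {a..x} (\<lambda>y. gut y t)) has_real_derivative gut u t) (at u)"
    using integral_has_real_derivative[OF c2, of u a b t]
    by (auto simp: at_within_Icc_at a_def b_def intro!: derivative_eq_intros)
  then show ?thesis
    by (rule has_field_derivative_transform_within_open[of _ _ _ "{a<..}"]) (simp, simp add: a_def, rule eq[symmetric], simp)
qed

lemma (in profile) Xu_zero:
  assumes "u \<le> 0" "0 \<le> t" "i \<in> {1..I}"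
  shows "Xu i u t = 0"
proof (rule vector_derivative_unique_within)
  \<comment> \<open>The left-sided derivative is used because \<open>X\<close> is known to vanish to
    the left of \<open>u\<close>; this includes \<open>u = 0\<close>.\<close>
  show "at u within {..u} \<noteq> bot" by (simp add: at_within_Iic_at_left)
  show "((\<lambda>x. X i x t) has_vector_derivative Xu i u t) (at u within {..u})"
    using X_du[OF assms(3)] by (simp add: has_real_derivative_iff_has_vector_derivative)
  show "((\<lambda>x. X i x t) has_vector_derivative 0) (at u within {..u})"
    by (rule has_vector_derivative_transform_within[where f="\<lambda>_. 0" and d=1]) (use X_zero assms in auto)
qed

text \<open>By \<open>X_transport\<close> the flux \<open>veff * Xu\<close> equals
  \<open>- Xt\<close> on the quadrant. Its derivative in \<open>u\<close> is therefore minus the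
  mixed derivative, that is, minus the time derivative of the density \<open>Xu\<close>.\<close>

lemma (in profile) sol_b_X:
  assumes k: "k = 1" and \<rho>: "inDdens I \<rho>" and i: "i \<in> {1..I}"
    and \<psi>: "\<And>i u. i \<in> {1..I} \<Longrightarrow> 0 \<le> u \<Longrightarrow> E i (phi I (\<lambda>i u. integral {0..u} (\<rho> i)) i u) = integral {0..u} (\<rho> i)"
  defines "\<xi> \<equiv> psi_flow I (\<lambda>i u. integral {0..u} (\<rho> i))"
  shows "sol_b I \<rho> (\<lambda>i u t. du (\<xi> i) u t)" "C2q (\<xi> i)" "nonnegq (\<xi> i)"
proof -
  have eq: "\<xi> i u t = X i u t" if "i \<in> {1..I}" "0 \<le> u" "0 \<le> t" for i u t
    unfolding \<xi>_def by (rule psi_flow_eq_X[OF inDdens_D_bound[OF \<rho>] \<psi> that])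
  show "C2q (\<xi> i)"
    by (rule C2q_I[OF X_grad[OF i] Ck_Xu[OF i, unfolded k] Ck_Xt[OF i, unfolded k] eq[OF i]])
  show "nonnegq (\<xi> i)" unfolding nonnegq_def using eq X_nonneg i by auto
  have du: "du (\<xi> i) u t = Xu i u t" if "i \<in> {1..I}" "0 \<le> u" "0 \<le> t" for i u t
    by (rule has_grad_du_Q[OF has_grad_cong_Q[where g="X i", OF X_grad eq]]) (use that in auto)
  have "C1q (du (\<xi> i))" if "i \<in> {1..I}" for i
    by (rule C1q_I[OF Ck_Xu[OF that, unfolded k]]) (use du that in auto)
  moreover have "nonnegq (du (\<xi> i))" if "i \<in> {1..I}" for i
    using du Xu_nonneg that by (auto simp: nonnegq_def)
  moreover have "inDdens I (\<lambda>i u. du (\<xi> i) u t)" if t: "0 \<le> t" for t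
  proof -
    have dc: "dcoef I (\<lambda>j. du (\<xi> j) u t) i = dcoef I (\<lambda>j. Xu j u t) i" if "0 \<le> u" for u i
      unfolding dcoef_def using du that t by (auto intro!: sum.cong)
    have "C1plus (\<lambda>u. du (\<xi> i) u t)" if "i \<in> {1..I}" for i
      by (rule C1plus_I[OF Ck_Xu[OF that, unfolded k], of t]) (use du Xu_zero Xu_nonneg t that in auto)
    moreover have "(\<Sum>i=1..I. 2 * real i * du (\<xi> i) u t) < 1" if "0 \<le> u" for u
    proof -
      have "(\<Sum>i=1..I. 2 * real i * du (\<xi> i) u t) = (\<Sum>j=1..I. 2 * real (min I j) * Xu j u t)"
        using du that t by (intro sum.cong) auto
      then show ?thesis using dcoef_Xu_pos[of I u t] I that t by (simp add: dcoef_def)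
    qed
    moreover have le: "x \<le> L i" if i: "i \<in> {1..I}" and x: "x \<in> dens_set I (\<lambda>i u. du (\<xi> i) u t) i" for i x
    proof -
      obtain u where u: "0 \<le> u" "x = Xu i u t / dcoef I (\<lambda>j. Xu j u t) i"
        using x dc du i t by (auto simp: dens_set_dcoef)
      then show ?thesis using Xu_le[OF i u(1) t] dcoef_Xu_pos[OF i u(1) t] by (simp add: pos_divide_le_eq)
    qed
    then have "bdd_above (dens_set I (\<lambda>i u. du (\<xi> i) u t) i)" if "i \<in> {1..I}" for i
      using that by (auto simp: bdd_above_def)
    moreover have "(\<Sum>i=1..I. real i * Sup (dens_set I (\<lambda>i u. du (\<xi> i) u t) i)) \<le> (\<Sum>i=1..I. real i * L i)"
      using le by (intro sum_mono mult_left_mono cSup_least) (auto simp: dens_set_def)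
    ultimately show ?thesis unfolding inDdens_def using L_sum by auto
  qed
  moreover have "((\<lambda>x. veff I (\<lambda>j. du (\<xi> j) x t) i * du (\<xi> i) x t) has_real_derivative - dt (du (\<xi> i)) u t)
      (at u within {0..})" if i: "i \<in> {1..I}" and u: "0 \<le> u" and t: "0 \<le> t" for i u t
  proof -
    obtain a b where ab: "\<And>u t. has_grad (Xu i) (a u t) (b u t) u t UNIV" "Ck 0 a" "Ck 0 b"
      using Ck_Xu[OF i, unfolded k] by (auto simp: One_nat_def)
    have b: "(Xu i u has_real_derivative b u t) (at t within S)" for u t S
      by (rule has_grad_dt[OF ab(1)]) auto
    have "dt (du (\<xi> i)) u t = dt (Xu i) u t" by (rule dt_cong) (use du i u t in auto)
    also have "\<dots> = b u t" by (rule dt_eq[OF t b])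
    finally have dtb: "dt (du (\<xi> i)) u t = b u t" .
    \<comment> \<open>Here \<open>b\<close> is the time derivative of \<open>Xu i\<close>, and the
      exchange of derivatives makes it the \<open>u\<close>-derivative of
      \<open>Xt i\<close>.\<close>
    have "((\<lambda>x. Xt i x t) has_real_derivative b u t) (at u)"
      by (rule mixed_partial[OF X_grad[OF i] Ck_continuous[OF Ck_Xu[OF i]] b]) (use ab(3) in simp)
    then have "((\<lambda>x. - Xt i x t) has_real_derivative - b u t) (at u within {0..})"
      by (rule DERIV_minus[OF has_field_derivative_at_within])
    then have "((\<lambda>x. veff I (\<lambda>j. du (\<xi> j) x t) i * du (\<xi> i) x t) has_real_derivative - b u t) (at u within {0..})"
    proof (rule has_field_derivative_transform_within[OF _ zero_less_one])
      fix x :: real assume "x \<in> {0..}"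
      then have x: "0 \<le> x" by simp
      have "veff I (\<lambda>j. du (\<xi> j) x t) = veff I (\<lambda>j. Xu j x t)" by (rule veff_cong) (rule du[OF _ x t])
      then show "- Xt i x t = veff I (\<lambda>j. du (\<xi> j) x t) i * du (\<xi> i) x t"
        using X_transport[OF i x t] du[OF i x t] by simp
    qed (use u in auto)
    then show ?thesis using dtb by simp
  qed
  moreover have "du (\<xi> i) u 0 = \<rho> i u" if i: "i \<in> {1..I}" and u: "0 \<le> u" for i u
  proof -
    have "du (\<xi> i) u 0 = du (\<lambda>u t. integral {0..u} (\<rho> i)) u 0"
      by (rule du_cong) (use eq X_initial[OF \<psi>] i u in auto)
    also have "\<dots> = \<rho> i u" by (rule du_eq[OF u]) (rule integral_deriv_within[OF inDdens_continuous[OF \<rho> i] u])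
    finally show ?thesis .
  qed
  ultimately show "sol_b I \<rho> (\<lambda>i u t. du (\<xi> i) u t)" unfolding sol_b_def by auto
qed

section \<open>From solutions for densities to solutions for primitives\<close>

lemma continuous_on_integral_Q:
  fixes f :: "real \<Rightarrow> real \<Rightarrow> real"
  assumes f: "continuous_on Q (\<lambda>p. f (fst p) (snd p))"
  shows "continuous_on Q (\<lambda>p. integral {0..fst p} (\<lambda>x. f x (snd p)))"
proof -
  \<comment> \<open>Substituting \<open>x = u * y\<close> replaces the moving interval by
    \<open>[0, 1]\<close>, where continuity in parameters applies.\<close>
  have "continuous_on (Q \<times> cbox 0 1) (\<lambda>q. f (fst (fst (fst q) * snd q, snd (fst q))) (snd (fst (fst q) * snd q, snd (fst q))))"
    by (rule continuous_on_compose2[OF f]) (auto intro!: continuous_intros simp: Q_def)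
  then have "continuous_on (Q \<times> cbox 0 1) (\<lambda>(p, y). f (fst p * y) (snd p))"
    by (simp add: case_prod_unfold)
  from integral_continuous_on_param[OF this]
  have "continuous_on Q (\<lambda>p. fst p * integral {0..1} (\<lambda>y. f (fst p * y) (snd p)))"
    by (auto intro!: continuous_intros)
  moreover have "fst p * integral {0..1} (\<lambda>y. f (fst p * y) (snd p)) = integral {0..fst p} (\<lambda>x. f x (snd p))"
    if "p \<in> Q" for p
  proof -
    have p: "0 \<le> fst p" "0 \<le> snd p" using that by (auto simp: Q_def)
    have "continuous_on {0..fst p} (\<lambda>x. f (fst (x, snd p)) (snd (x, snd p)))"
      by (rule continuous_on_compose2[OF f]) (use p in \<open>auto intro!: continuous_intros simp: Q_def\<close>)
    then have "((\<lambda>y. fst p *\<^sub>R f (fst p * y) (snd p)) has_integral (integral {fst p * 0..fst p * 1} (\<lambda>x. f x (snd p)))) {0..1}"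
      using p by (intro has_integral_substitution[where c=0 and d="fst p"])
        (auto intro!: derivative_eq_intros simp: mult_left_le)
    from integral_unique[OF this] show ?thesis by simp
  qed
  ultimately show ?thesis by (rule continuous_on_eq)
qed

text \<open>The increment splits into a step in \<open>u\<close>, controlled by the derivative at
  \<open>(u, t)\<close>, and a step in \<open>t\<close>, controlled by the continuity of
  \<open>gt\<close>.\<close>

lemma has_grad_of_partials:
  assumes u: "((\<lambda>x. g x t) has_real_derivative a) (at u within {0..})"
    and t: "\<And>u t. 0 \<le> u \<Longrightarrow> 0 \<le> t \<Longrightarrow> (g u has_real_derivative gt u t) (at t within {0..})"
    and cont: "continuous_on Q (\<lambda>p. gt (fst p) (snd p))" and "0 \<le> u" "0 \<le> t"
  shows "has_grad g a (gt u t) u t Q"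
proof -
  have "continuous_on Q (\<lambda>p. blinfun_mult_right (gt (fst p) (snd p)))"
    by (intro bounded_linear.continuous_on[OF bounded_linear_blinfun_mult_right] cont)
  then have "continuous (at (u, t) within {0..} \<times> {0..}) (\<lambda>(x, y). blinfun_mult_right (gt x y))"
    using assms(4,5) by (auto simp: continuous_on_eq_continuous_within Q_def case_prod_unfold)
  then have "((\<lambda>(x, y). g x y) has_derivative (\<lambda>(tx, ty). a * tx + blinfun_mult_right (gt u t) ty))
      (at (u, t) within {0..} \<times> {0..})"
    using u t assms(4,5)
    by (intro has_derivative_partialsI) (auto simp: has_field_derivative_def)
  then show ?thesis by (simp add: case_prod_unfold Q_def)
qed

text \<open>Integrating the conservation law over \<open>{0..u}\<close> gives the transport equation
  for the primitive, as the flux at 0 vanishes with the density. Uniqueness for densities thereby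
  reduces to part (a).\<close>

lemma sol_b_imp_sol_a:
  assumes I: "I \<ge> 1" and sol: "sol_b I \<rho>0 \<rho>"
  shows "sol_a I (\<lambda>i u. integral {0..u} (\<rho>0 i)) (\<lambda>i u t. integral {0..u} (\<lambda>x. \<rho> i x t))"
    and "i \<in> {1..I} \<Longrightarrow> 0 \<le> u \<Longrightarrow> 0 \<le> t \<Longrightarrow> du (\<lambda>u t. integral {0..u} (\<lambda>x. \<rho> i x t)) u t = \<rho> i u t"
proof -
  define \<xi> where "\<xi> i u t = integral {0..u} (\<lambda>x. \<rho> i x t)" for i u t
  have C: "C1q (\<rho> i)" if "i \<in> {1..I}" for i using sol that unfolding sol_b_def by blast
  have Dd: "inDdens I (\<lambda>i u. \<rho> i u t)" if "0 \<le> t" for t using sol that unfolding sol_b_def by blast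
  have pde: "((\<lambda>x. veff I (\<lambda>j. \<rho> j x t) i * \<rho> i x t) has_real_derivative - dt (\<rho> i) u t) (at u within {0..})"
    if "i \<in> {1..I}" "0 \<le> u" "0 \<le> t" for i u t using sol that unfolding sol_b_def by blast
  have init: "\<rho> i u 0 = \<rho>0 i u" if "i \<in> {1..I}" "0 \<le> u" for i u using sol that unfolding sol_b_def by blast
  have grad: "has_grad (\<rho> i) (du (\<rho> i) u t) (dt (\<rho> i) u t) u t Q" if "i \<in> {1..I}" "0 \<le> u" "0 \<le> t" for i u t
    using C[OF that(1)] that by (blast elim: C1qE)
  have cdt: "continuous_on Q (\<lambda>p. dt (\<rho> i) (fst p) (snd p))" if "i \<in> {1..I}" for i
    using C[OF that] by (blast elim: C1qE)
  have c\<rho>: "continuous_on Q (\<lambda>p. \<rho> i (fst p) (snd p))" if "i \<in> {1..I}" for i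
    using has_derivative_continuous[OF grad[OF that]]
    by (auto simp: continuous_on_eq_continuous_within Q_def)
  have uc: "continuous_on UNIV (ext0 (\<lambda>u. \<rho> i u t))" if "i \<in> {1..I}" "0 \<le> t" for i t
    using inDdens_continuous[OF Dd[OF that(2)] that(1)] .
  have \<xi>u: "((\<lambda>x. \<xi> i x t) has_real_derivative \<rho> i u t) (at u within {0..})"
    if "i \<in> {1..I}" "0 \<le> u" "0 \<le> t" for i u t
    unfolding \<xi>_def by (rule integral_deriv_within[OF uc]) (use that in auto)
  define h where "h i u t = integral {0..u} (\<lambda>x. dt (\<rho> i) x t)" for i u t
  have \<xi>t: "(\<xi> i u has_real_derivative h i u t) (at t within {0..})"
    if i: "i \<in> {1..I}" and "0 \<le> u" "0 \<le> t" for i u t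
  proof -
    have "((\<lambda>s. integral (cbox 0 u) (\<lambda>x. \<rho> i x s)) has_real_derivative integral (cbox 0 u) (\<lambda>x. dt (\<rho> i) x t))
        (at t within {0..})"
    proof (rule leibniz_rule_field_derivative)
      show "((\<lambda>s. \<rho> i x s) has_real_derivative dt (\<rho> i) x s) (at s within {0..})"
        if "s \<in> {0..}" "x \<in> cbox 0 u" for s x
        by (rule has_grad_dt[OF grad[OF i]]) (use that in \<open>auto simp: Q_def\<close>)
      show "(\<lambda>x. \<rho> i x s) integrable_on cbox 0 u" if "s \<in> {0..}" for s
      proof -
        have "continuous_on {0..u} (\<lambda>x. ext0 (\<lambda>u. \<rho> i u s) x)"
          using uc[OF i] that by (auto intro: continuous_on_subset)
        then have "continuous_on {0..u} (\<lambda>x. \<rho> i x s)" by (rule continuous_on_eq) auto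
        then show ?thesis by (auto intro: integrable_continuous_real)
      qed
      have "continuous_on ({0..} \<times> cbox 0 u) (\<lambda>q. dt (\<rho> i) (fst (snd q, fst q)) (snd (snd q, fst q)))"
        by (rule continuous_on_compose2[OF cdt[OF i]]) (auto intro!: continuous_intros simp: Q_def)
      then show "continuous_on ({0..} \<times> cbox 0 u) (\<lambda>(s, x). dt (\<rho> i) x s)" by (simp add: case_prod_unfold)
    qed (use that in auto)
    then show ?thesis unfolding \<xi>_def h_def by simp
  qed
  have hc: "continuous_on Q (\<lambda>p. h i (fst p) (snd p))" if "i \<in> {1..I}" for i
    unfolding h_def by (rule continuous_on_integral_Q[OF cdt[OF that]])
  have \<xi>g: "has_grad (\<xi> i) (\<rho> i u t) (h i u t) u t Q" if "i \<in> {1..I}" "0 \<le> u" "0 \<le> t" for i u t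
    by (rule has_grad_of_partials[OF \<xi>u \<xi>t hc]) (use that in auto)
  \<comment> \<open>The integral of \<open>- dt (\<rho> i)\<close> is the difference of the flux
    \<open>?F\<close> at \<open>u\<close> and at 0, where \<open>\<rho> i 0 t = 0\<close>.\<close>
  have h: "h i u t = - veff I (\<lambda>j. \<rho> j u t) i * \<rho> i u t" if i: "i \<in> {1..I}" and u: "0 \<le> u" and t: "0 \<le> t" for i u t
  proof -
    let ?F = "\<lambda>x. veff I (\<lambda>j. \<rho> j x t) i * \<rho> i x t"
    have "((\<lambda>x. - dt (\<rho> i) x t) has_integral (?F u - ?F 0)) {0..u}"
    proof (rule fundamental_theorem_of_calculus[OF u])
      fix x assume x: "x \<in> {0..u}"
      then have "(?F has_real_derivative - dt (\<rho> i) x t) (at x within {0..u})"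
        by (intro DERIV_subset[OF pde[OF i _ t]]) auto
      then show "(?F has_vector_derivative - dt (\<rho> i) x t) (at x within {0..u})"
        by (simp add: has_real_derivative_iff_has_vector_derivative)
    qed
    moreover have "\<rho> i 0 t = 0" using ext0_continuous_zero[OF uc[OF i t]] .
    ultimately have "((\<lambda>x. - dt (\<rho> i) x t) has_integral ?F u) {0..u}" by simp
    from has_integral_neg[OF this] show ?thesis unfolding h_def by (simp add: integral_unique)
  qed
  have du\<xi>: "du (\<xi> i) u t = \<rho> i u t" if "i \<in> {1..I}" "0 \<le> u" "0 \<le> t" for i u t
    by (rule has_grad_du_Q[OF \<xi>g]) (use that in auto)
  then show "i \<in> {1..I} \<Longrightarrow> 0 \<le> u \<Longrightarrow> 0 \<le> t \<Longrightarrow> du (\<lambda>u t. integral {0..u} (\<lambda>x. \<rho> i x t)) u t = \<rho> i u t"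
    unfolding \<xi>_def[abs_def] by blast
  have dt\<xi>: "dt (\<xi> i) u t = h i u t" if "i \<in> {1..I}" "0 \<le> u" "0 \<le> t" for i u t
    by (rule has_grad_dt_Q[OF \<xi>g]) (use that in auto)
  have Db: "D_bound I (\<lambda>i u. \<xi> i u t) (\<lambda>i. Sup (dens_set I (\<lambda>i u. \<rho> i u t) i))" if "0 \<le> t" for t
    unfolding \<xi>_def by (rule inDdens_D_bound[OF Dd[OF that]])
  have "C1q (\<xi> i)" if "i \<in> {1..I}" for i
    unfolding C1q_def using \<xi>g hc c\<rho> that by blast
  moreover have pos: "0 \<le> \<xi> i u t" if "i \<in> {1..I}" "0 \<le> u" "0 \<le> t" for i u t
    using D_bound_Cc[OF Db[OF that(3)] that(1)] that by (auto simp: Cc_def)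
  moreover have "inD1 I (\<lambda>i u. \<xi> i u t)" if t: "0 \<le> t" for t
  proof -
    have "C1plus (\<lambda>u. \<xi> i u t)" if "i \<in> {1..I}" for i
      using Ck_SucD[OF inDdens_Ck_integral[OF Dd[OF t] that]] pos[OF that _ t] unfolding C1plus_iff \<xi>_def by blast
    then show ?thesis unfolding inD1_def using D_bound_imp_inD[OF Db[OF t] I] by blast
  qed
  moreover have "dt (\<xi> i) u t = - veff I (\<lambda>j. du (\<xi> j) u t) i * du (\<xi> i) u t"
    if "i \<in> {1..I}" "0 \<le> u" "0 \<le> t" for i u t
    using dt\<xi> h du\<xi> veff_cong[of I "\<lambda>j. du (\<xi> j) u t" "\<lambda>j. \<rho> j u t"] that by simp
  moreover have "\<xi> i u 0 = integral {0..u} (\<rho>0 i)" if "i \<in> {1..I}" "0 \<le> u" for i u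
    unfolding \<xi>_def using init that by (intro integral_cong) auto
  ultimately have "sol_a I (\<lambda>i u. integral {0..u} (\<rho>0 i)) \<xi>"
    unfolding sol_a_def nonnegq_def by auto
  then show "sol_a I (\<lambda>i u. integral {0..u} (\<rho>0 i)) (\<lambda>i u t. integral {0..u} (\<lambda>x. \<rho> i x t))"
    unfolding \<xi>_def[abs_def] .
qed

section \<open>Choice of the profiles and conclusion of both parts\<close>

lemma profile_obtain:
  assumes I: "I \<ge> 1" and D: "D_bound I \<psi> L"
    and k: "\<And>i. i \<in> {1..I} \<Longrightarrow> Ck (Suc k) (\<lambda>x t. ext0 (\<psi> i) x)"
  obtains E where "profile I L E k" "\<And>i u. i \<in> {1..I} \<Longrightarrow> 0 \<le> u \<Longrightarrow> E i (phi I \<psi> i u) = \<psi> i u"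
proof -
  have "\<exists>E. \<forall>i\<in>{1..I}. Ck (Suc k) (\<lambda>z t. E i z) \<and> (\<forall>z\<le>0. E i z = 0) \<and> mono (E i) \<and>
    (\<forall>x y. x \<le> y \<longrightarrow> E i y - E i x \<le> L i * (y - x)) \<and> (\<forall>u\<ge>0. E i (phi I \<psi> i u) = \<psi> i u)"
    using profile_exists[OF D k] by (intro bchoice) blast
  then obtain E where E: "\<And>i. i \<in> {1..I} \<Longrightarrow> Ck (Suc k) (\<lambda>z t. E i z) \<and> (\<forall>z\<le>0. E i z = 0) \<and> mono (E i) \<and>
    (\<forall>x y. x \<le> y \<longrightarrow> E i y - E i x \<le> L i * (y - x)) \<and> (\<forall>u\<ge>0. E i (phi I \<psi> i u) = \<psi> i u)" by blast
  have "profile I L E k"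
    by unfold_locales (use I E D in \<open>auto simp: D_bound_def simp del: Ck.simps\<close>)
  then show thesis using that E by blast
qed

theorem theorem1p5:
  fixes I :: nat
  assumes "I \<ge> 1"
  shows
    "(\<forall>\<psi>0. inD1 I \<psi>0 \<longrightarrow>
        sol_a I \<psi>0 (psi_flow I \<psi>0) \<and>
        (\<forall>\<psi>. sol_a I \<psi>0 \<psi> \<longrightarrow>
           (\<forall>i\<in>{1..I}. \<forall>u\<ge>0. \<forall>t\<ge>0. \<psi> i u t = psi_flow I \<psi>0 i u t)))
     \<and>
     (\<forall>\<rho>0. inDdens I \<rho>0 \<longrightarrow>
        (let \<psi> = psi_flow I (\<lambda>i u. integral {0..u} (\<rho>0 i));
             \<rho> = (\<lambda>i u t. du (\<psi> i) u t) in
          (\<forall>i\<in>{1..I}. C2q (\<psi> i) \<and> nonnegq (\<psi> i)) \<and>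
          sol_b I \<rho>0 \<rho> \<and>
          (\<forall>\<rho>'. sol_b I \<rho>0 \<rho>' \<longrightarrow>
             (\<forall>i\<in>{1..I}. \<forall>u\<ge>0. \<forall>t\<ge>0. \<rho>' i u t = \<rho> i u t))))"
proof -
  \<comment> \<open>Stated for arbitrary \<open>L\<close>, \<open>E\<close> and \<open>k\<close>,
    since part (b) applies it to the primitive of a competing density.\<close>
  have uniq: "\<xi> i u t = psi_flow I \<psi> i u t"
    if E: "profile I L E k" "\<And>i u. i \<in> {1..I} \<Longrightarrow> 0 \<le> u \<Longrightarrow> E i (phi I \<psi> i u) = \<psi> i u"
      and D: "D_bound I \<psi> L" and sol: "sol_a I \<psi> \<xi>" and u: "i \<in> {1..I}" "0 \<le> u" "0 \<le> t"
    for \<psi> \<xi> L E k i u t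
    using profile.sol_a_unique[OF E sol u] profile.psi_flow_eq_X[OF E(1) D E(2) u] by simp
  show ?thesis
  proof (intro conjI allI impI)
    fix \<psi> assume \<psi>: "inD1 I \<psi>"
    define L where "L i = Sup (ratio_set I \<psi> i)" for i
    have D: "D_bound I \<psi> L"
      unfolding L_def using \<psi> inD_imp_D_bound by (auto simp: inD1_def)
    have "Ck (Suc 0) (\<lambda>x t. ext0 (\<psi> i) x)" if "i \<in> {1..I}" for i
      using \<psi> that unfolding inD1_def C1plus_iff One_nat_def by blast
    from profile_obtain[OF assms D this] obtain E where
      E: "profile I L E 0" "\<And>i u. i \<in> {1..I} \<Longrightarrow> 0 \<le> u \<Longrightarrow> E i (phi I \<psi> i u) = \<psi> i u" by blast
    show "sol_a I \<psi> (psi_flow I \<psi>)" by (rule profile.sol_a_X[OF E(1) D E(2)])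
    fix \<xi> assume "sol_a I \<psi> \<xi>"
    then show "\<forall>i\<in>{1..I}. \<forall>u\<ge>0. \<forall>t\<ge>0. \<xi> i u t = psi_flow I \<psi> i u t"
      using uniq[OF E D] by blast
  next
    fix \<rho> assume \<rho>: "inDdens I \<rho>"
    define L where "L i = Sup (dens_set I \<rho> i)" for i
    define \<psi> where "\<psi> i u = integral {0..u} (\<rho> i)" for i u
    have D: "D_bound I \<psi> L"
      unfolding L_def \<psi>_def by (rule inDdens_D_bound[OF \<rho>])
    have "Ck (Suc 1) (\<lambda>x t. ext0 (\<psi> i) x)" if "i \<in> {1..I}" for i
      unfolding \<psi>_def by (rule inDdens_Ck_integral[OF \<rho> that])
    from profile_obtain[OF assms D this] obtain E where
      E: "profile I L E 1" "\<And>i u. i \<in> {1..I} \<Longrightarrow> 0 \<le> u \<Longrightarrow> E i (phi I \<psi> i u) = \<psi> i u" by blast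
    note b = profile.sol_b_X[OF E(1) refl \<rho> _ E(2)[unfolded \<psi>_def], folded \<psi>_def]
    have "\<rho>' i u t = du (psi_flow I \<psi> i) u t"
      if sol: "sol_b I \<rho> \<rho>'" and u: "i \<in> {1..I}" "0 \<le> u" "0 \<le> t" for \<rho>' i u t
    proof -
      note a = sol_b_imp_sol_a[OF assms sol, folded \<psi>_def]
      \<comment> \<open>The primitive of \<open>\<rho>'\<close> solves the problem of part (a) and
        so equals the flow; taking \<open>u\<close>-derivatives compares the densities.\<close>
      have "du (psi_flow I \<psi> i) u t = du (\<lambda>u t. integral {0..u} (\<lambda>x. \<rho>' i x t)) u t"
        by (rule du_cong) (use uniq[OF E D a(1)] u in auto)
      then show ?thesis using a(2)[OF u] by simp
    qed
    moreover have "sol_b I \<rho> (\<lambda>i u t. du (psi_flow I \<psi> i) u t)" using b(1)[of I] assms by simp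
    ultimately show "let \<psi> = psi_flow I (\<lambda>i u. integral {0..u} (\<rho> i));
             \<rho>' = (\<lambda>i u t. du (\<psi> i) u t) in
          (\<forall>i\<in>{1..I}. C2q (\<psi> i) \<and> nonnegq (\<psi> i)) \<and>
          sol_b I \<rho> \<rho>' \<and>
          (\<forall>\<rho>''. sol_b I \<rho> \<rho>'' \<longrightarrow>
             (\<forall>i\<in>{1..I}. \<forall>u\<ge>0. \<forall>t\<ge>0. \<rho>'' i u t = \<rho>' i u t))"
      unfolding Let_def \<psi>_def[symmetric, abs_def] using b(2,3) by blast
  qed
qed

end
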